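(* Let $\lambda/\mu$ be a skew partition that is connected and has no empty columns, and let $\nu$ be a partition that is representable with respect to $\lambda/\mu$. Then the map $\mathbf B:\operatorname{RPP}^{12}(\lambda/\mu;\nu)\to\operatorname{RPP}^{12}(\lambda/\mu;\nu)$ is the unique involution on $\operatorname{RPP}^{12}(\lambda/\mu;\nu)$ that interchanges the number of 1-pure columns with the number of 2-pure columns inside each irreducible component of $\nu$. (That is, $\mathbf B$ is the unique involution $f$ such that for every $T$ and every $0\le k\le r$, the numbers of 1-pure and of 2-pure columns of $f(T)$ among the columns $b_k,b_k+1,\ldots,a_{k+1}-1$ equal, respectively, the numbers of 2-pure and of 1-pure columns of $T$ among these columns.)
   Context: A partition $\lambda=(\lambda_1\ge\lambda_2\ge\cdots)$ is identified with its Young diagram $\{(i,j)\in\mathbb N_+^2\mid j\le\lambda_i\}$ ($i$ is the row, growing downwards; $j$ is the column). A skew partition $\lambda/\mu$ is a pair of partitions with $\mu\subseteq\lambda$, also identified with the set difference of the diagrams. "Connected" means connected as a subgraph of $\mathbb Z^2$, two cells being adjacent if they share an edge; "no empty columns" means each of the columns $1,\ldots,\lambda_1$ contains a cell of $\lambda/\mu$. 12-tables. A 12-table is a map $T:\lambda/\mu\to\{1,2\}$ weakly increasing down columns; a 12-rpp is a 12-table that is also weakly increasing from left to right along rows. A column is 1-pure (2-pure) if it is nonempty and all its entries are 1 (resp. 2), mixed if it contains both 1's and 2's. If column $k$ of $T$ is mixed, $\operatorname{sep}_kT$ is the smallest $r$ with $(r,k)\in\lambda/\mu$, $T(r,k)=2$.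 A 12-table is benign if the values $\operatorname{sep}_kT$, listed over all mixed columns $k$ in increasing order of $k$, are weakly decreasing. $\operatorname{flip}(T)$ is obtained from $T$ by making every 1-pure column 2-pure and every 2-pure column 1-pure, leaving other columns unchanged. A descent of $T$ is a $k\ge 1$ such that for some $r$ the cells $(r,k),(r,k+1)$ lie in $\lambda/\mu$ and $T(r,k)=2$, $T(r,k+1)=1$. If $k$ is a descent of a benign 12-table $P$, then exactly one of the following holds, and $\operatorname{res}_kP$ ("resolving $k$") is the benign 12-table differing from $P$ only in columns $k,k+1$ and defined by: (M1) column $k$ of $P$ mixed, column $k+1$ 1-pure: in $\operatorname{res}_kP$ column $k$ is 1-pure and column $k+1$ is mixed with $\operatorname{sep}_{k+1}(\operatorname{res}_kP)=\operatorname{sep}_kP$; (2M) column $k$ 2-pure, column $k+1$ mixed: in $\operatorname{res}_kP$ column $k$ is mixed with $\operatorname{sep}_k(\operatorname{res}_kP)=\operatorname{sep}_{k+1}P$ and column $k+1$ is 2-pure; (21) column $k$ 2-pure, column $k+1$ 1-pure: in $\operatorname{res}_kP$ column $k$ is 1-pure and column $k+1$ is 2-pure. For every benign 12-table $P$ there is a unique 12-rpp, denoted $\operatorname{norm}(P)$, obtainable from $P$ by a finite (possibly empty) sequence of descent resolutions. For a 12-rpp $T$ (which is always benign, as is $\operatorname{flip}(T)$), $\mathbf B(T):=\operatorname{norm}(\operatorname{flip}(T))$. Seplist. For a 12-rpp $T$, let $\{(i_1,j_1),\ldots,(i_s,j_s)\}$ with $j_1<\cdots<j_s$ be the set of all cells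 $(i,j)\in\lambda/\mu$ with $T(i,j)=1$, $(i+1,j)\in\lambda/\mu$, $T(i+1,j)=2$; then $i_1\ge\cdots\ge i_s$ and $\operatorname{seplist}(T):=(i_1,\ldots,i_s)$. $\operatorname{RPP}^{12}(\lambda/\mu;\nu)$ is the set of 12-rpps $T$ of shape $\lambda/\mu$ with $\operatorname{seplist}(T)=\nu$; $\mathbf B$ maps this set to itself. Irreducible components. $\operatorname{supp}(i)=\{j\mid (i,j),(i+1,j)\in\lambda/\mu\}=[\mu_i+1,\lambda_{i+1}]$. A partition $\nu=(i_1\ge\cdots\ge i_s>0)$ is admissible if $\operatorname{supp}(i_k)\ne\varnothing$ for all $k$. For integers $a\le b$, $\nu|_{\subseteq[a,b)}$ (resp. $\nu|_{\cap[a,b)}$) is the subpartition of those entries $i_k$ (with multiplicity) with $\operatorname{supp}(i_k)\subseteq[a,b)$ (resp. $\operatorname{supp}(i_k)\cap[a,b)\ne\varnothing$); $\#$ denotes number of entries. An admissible $\nu$ is representable if $\#\nu|_{\subseteq[a,b)}\le b-a$ for all integers $a<b$. For representable $\nu$ there are a unique $r\ge0$ and unique integers $1=b_0\le a_1<b_1<a_2<\cdots<a_r<b_r\le a_{r+1}=\lambda_1+1$ such that (1) $\#\nu|_{\subseteq[a_k,b_k)}=b_k-a_k$ for $1\le k\le r$, and (2) $\bigcup_{k=0}^r[b_k,a_{k+1})$ is inclusion-minimal among all such sequences satisfying (1). The irreducible components of $\nu$ are the $\nu|_{\cap[b_k,a_{k+1})}$, $0\le k\le r$; the $k$-th one corresponds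 to the columns in $[b_k,a_{k+1})$. *)

theory Defs
  imports Main "HOL-Library.FuncSet"
begin

definition is_partition :: "nat list \<Rightarrow> bool" where
  "is_partition xs \<longleftrightarrow> sorted_wrt (\<ge>) xs \<and> 0 \<notin> set xs"

text \<open>Parts are indexed from 1; parts beyond the length of the list are 0.\<close>

definition part :: "nat list \<Rightarrow> nat \<Rightarrow> nat" where
  "part xs i = (if 1 \<le> i \<and> i \<le> length xs then xs ! (i - 1) else 0)"

type_synonym cell = "nat \<times> nat"

definition diagram :: "nat list \<Rightarrow> cell set" where
  "diagram la = {(i, j). 1 \<le> i \<and> 1 \<le> j \<and> j \<le> part la i}"

definition skew_partition :: "nat list \<Rightarrow> nat list \<Rightarrow> bool" where
  "skew_partition la mu \<longleftrightarrow> is_partition la \<and> is_partition mu \<and> diagram mu \<subseteq> diagram la"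

definition skew :: "nat list \<Rightarrow> nat list \<Rightarrow> cell set" where
  "skew la mu = diagram la - diagram mu"

fun adjacent :: "cell \<Rightarrow> cell \<Rightarrow> bool" where
  "adjacent (i, j) (i', j') \<longleftrightarrow>
     (i = i' \<and> (j' = Suc j \<or> j = Suc j')) \<or> (j = j' \<and> (i' = Suc i \<or> i = Suc i'))"

definition connected_cells :: "cell set \<Rightarrow> bool" where
  "connected_cells S \<longleftrightarrow>
     (\<forall>c\<in>S. \<forall>d\<in>S. (\<lambda>x y. x \<in> S \<and> y \<in> S \<and> adjacent x y)\<^sup>*\<^sup>* c d)"

definition no_empty_columns :: "nat list \<Rightarrow> nat list \<Rightarrow> bool" where
  "no_empty_columns la mu \<longleftrightarrow> (\<forall>j\<in>{1..part la 1}. \<exists>i. (i, j) \<in> skew la mu)"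

text \<open>Tables are extensional functions (\<open>undefined\<close> off the shape), so that equality of
  functions is equality of tables.\<close>

type_synonym table = "cell \<Rightarrow> nat"

definition table12 :: "cell set \<Rightarrow> table \<Rightarrow> bool" where
  "table12 S T \<longleftrightarrow> T \<in> S \<rightarrow>\<^sub>E {1, 2} \<and>
     (\<forall>i i' j. (i, j) \<in> S \<and> (i', j) \<in> S \<and> i \<le> i' \<longrightarrow> T (i, j) \<le> T (i', j))"

definition rpp12 :: "cell set \<Rightarrow> table \<Rightarrow> bool" where
  "rpp12 S T \<longleftrightarrow> table12 S T \<and>
     (\<forall>i j j'. (i, j) \<in> S \<and> (i, j') \<in> S \<and> j \<le> j' \<longrightarrow> T (i, j) \<le> T (i, j'))"

definition pure :: "nat \<Rightarrow> cell set \<Rightarrow> table \<Rightarrow> nat \<Rightarrow> bool" where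
  "pure v S T k \<longleftrightarrow> (\<exists>i. (i, k) \<in> S) \<and> (\<forall>i. (i, k) \<in> S \<longrightarrow> T (i, k) = v)"

definition mixed :: "cell set \<Rightarrow> table \<Rightarrow> nat \<Rightarrow> bool" where
  "mixed S T k \<longleftrightarrow> (\<exists>i. (i, k) \<in> S \<and> T (i, k) = 1) \<and> (\<exists>i. (i, k) \<in> S \<and> T (i, k) = 2)"

definition sep :: "cell set \<Rightarrow> table \<Rightarrow> nat \<Rightarrow> nat" where
  "sep S T k = (LEAST r. (r, k) \<in> S \<and> T (r, k) = 2)"

definition benign :: "cell set \<Rightarrow> table \<Rightarrow> bool" where
  "benign S T \<longleftrightarrow> table12 S T \<and>
     (\<forall>k l. k < l \<and> mixed S T k \<and> mixed S T l \<longrightarrow> sep S T l \<le> sep S T k)"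

definition flip :: "cell set \<Rightarrow> table \<Rightarrow> table" where
  "flip S T = restrict
     (\<lambda>(i, j). if pure 1 S T j then 2 else if pure 2 S T j then 1 else T (i, j)) S"

definition descent :: "cell set \<Rightarrow> table \<Rightarrow> nat \<Rightarrow> bool" where
  "descent S T k \<longleftrightarrow> 1 \<le> k \<and>
     (\<exists>r. (r, k) \<in> S \<and> (r, k + 1) \<in> S \<and> T (r, k) = 2 \<and> T (r, k + 1) = 1)"

text \<open>\<open>resolves S k P Q\<close> says that \<open>Q\<close> is the result of resolving \<open>k\<close> in \<open>P\<close>. The three
  alternatives are the cases (M1), (2M) and (21); each determines columns \<open>k\<close> and \<open>k + 1\<close> of
  \<open>Q\<close>, because a table is determined on a mixed column by its \<open>sep\<close> value.\<close>

definition resolves :: "cell set \<Rightarrow> nat \<Rightarrow> table \<Rightarrow> table \<Rightarrow> bool" where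
  "resolves S k P Q \<longleftrightarrow> benign S P \<and> descent S P k \<and> benign S Q \<and>
     (\<forall>i j. (i, j) \<in> S \<and> j \<noteq> k \<and> j \<noteq> k + 1 \<longrightarrow> Q (i, j) = P (i, j)) \<and>
     ((mixed S P k \<and> pure 1 S P (k + 1) \<and>
        pure 1 S Q k \<and> mixed S Q (k + 1) \<and> sep S Q (k + 1) = sep S P k) \<or>
      (pure 2 S P k \<and> mixed S P (k + 1) \<and>
        mixed S Q k \<and> sep S Q k = sep S P (k + 1) \<and> pure 2 S Q (k + 1)) \<or>
      (pure 2 S P k \<and> pure 1 S P (k + 1) \<and>
        pure 1 S Q k \<and> pure 2 S Q (k + 1)))"

definition norm12 :: "cell set \<Rightarrow> table \<Rightarrow> table" where
  "norm12 S P = (THE Q. rpp12 S Q \<and> (\<lambda>P Q. \<exists>k. resolves S k P Q)\<^sup>*\<^sup>* P Q)"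

definition B :: "cell set \<Rightarrow> table \<Rightarrow> table" where
  "B S T = norm12 S (flip S T)"

definition sep_cells :: "cell set \<Rightarrow> table \<Rightarrow> cell set" where
  "sep_cells S T =
     {(i, j). (i, j) \<in> S \<and> T (i, j) = 1 \<and> (i + 1, j) \<in> S \<and> T (i + 1, j) = 2}"

text \<open>A 12-table has at most one such cell in each column, so listing the cells by increasing
  column amounts to listing the columns.\<close>

definition seplist :: "cell set \<Rightarrow> table \<Rightarrow> nat list" where
  "seplist S T =
     map (\<lambda>j. THE i. (i, j) \<in> sep_cells S T) (sorted_list_of_set (snd ` sep_cells S T))"

definition RPP12 :: "cell set \<Rightarrow> nat list \<Rightarrow> table set" where
  "RPP12 S nu = {T. rpp12 S T \<and> seplist S T = nu}"

definition supp :: "cell set \<Rightarrow> nat \<Rightarrow> nat set" where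
  "supp S i = {j. (i, j) \<in> S \<and> (i + 1, j) \<in> S}"

definition admissible :: "cell set \<Rightarrow> nat list \<Rightarrow> bool" where
  "admissible S nu \<longleftrightarrow> is_partition nu \<and> (\<forall>i\<in>set nu. supp S i \<noteq> {})"

definition sub_within :: "cell set \<Rightarrow> nat list \<Rightarrow> int \<Rightarrow> int \<Rightarrow> nat list" where
  "sub_within S nu a b = filter (\<lambda>i. int ` supp S i \<subseteq> {a..<b}) nu"

definition representable :: "cell set \<Rightarrow> nat list \<Rightarrow> bool" where
  "representable S nu \<longleftrightarrow> admissible S nu \<and>
     (\<forall>a b. a < b \<longrightarrow> int (length (sub_within S nu a b)) \<le> b - a)"

text \<open>A sequence \<open>1 = b\<^sub>0 \<le> a\<^sub>1 < b\<^sub>1 < a\<^sub>2 < \<dots> < a\<^sub>r < b\<^sub>r \<le> a\<^sub>r\<^sub>+\<^sub>1 = m + 1\<close> is encoded as the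
  list of the \<open>r + 1\<close> pairs \<open>(b\<^sub>k, a\<^sub>k\<^sub>+\<^sub>1)\<close>, \<open>0 \<le> k \<le> r\<close>. Only the first and the last of the
  inequalities between \<open>b\<^sub>k\<close> and \<open>a\<^sub>k\<^sub>+\<^sub>1\<close> are weak.\<close>

definition cut_sequence :: "nat \<Rightarrow> (int \<times> int) list \<Rightarrow> bool" where
  "cut_sequence m cs \<longleftrightarrow> cs \<noteq> [] \<and> fst (hd cs) = 1 \<and> snd (last cs) = int m + 1 \<and>
     (\<forall>k < length cs. fst (cs ! k) \<le> snd (cs ! k)) \<and>
     (\<forall>k. 0 < k \<and> k + 1 < length cs \<longrightarrow> fst (cs ! k) < snd (cs ! k)) \<and>
     (\<forall>k. k + 1 < length cs \<longrightarrow> snd (cs ! k) < fst (cs ! (k + 1)))"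

definition tight_cuts :: "cell set \<Rightarrow> nat \<Rightarrow> nat list \<Rightarrow> (int \<times> int) list \<Rightarrow> bool" where
  "tight_cuts S m nu cs \<longleftrightarrow> cut_sequence m cs \<and>
     (\<forall>k. k + 1 < length cs \<longrightarrow>
        int (length (sub_within S nu (snd (cs ! k)) (fst (cs ! (k + 1))))) =
          fst (cs ! (k + 1)) - snd (cs ! k))"

definition cut_union :: "(int \<times> int) list \<Rightarrow> int set" where
  "cut_union cs = (\<Union>(b, a)\<in>set cs. {b..<a})"

text \<open>The intervals \<open>[b\<^sub>k, a\<^sub>k\<^sub>+\<^sub>1)\<close> of columns corresponding to the irreducible components of
  \<open>nu\<close>.\<close>

definition component_columns :: "nat list \<Rightarrow> nat list \<Rightarrow> nat list \<Rightarrow> (int \<times> int) list" where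
  "component_columns la mu nu =
     (THE cs. tight_cuts (skew la mu) (part la 1) nu cs \<and>
        \<not> (\<exists>cs'. tight_cuts (skew la mu) (part la 1) nu cs' \<and> cut_union cs' \<subset> cut_union cs))"

definition pure_count :: "nat \<Rightarrow> cell set \<Rightarrow> table \<Rightarrow> int \<Rightarrow> int \<Rightarrow> nat" where
  "pure_count v S T b a = card {j. b \<le> int j \<and> int j < a \<and> pure v S T j}"

definition interchanges_pure ::
    "nat list \<Rightarrow> nat list \<Rightarrow> nat list \<Rightarrow> (table \<Rightarrow> table) \<Rightarrow> bool" where
  "interchanges_pure la mu nu f \<longleftrightarrow>
     (\<forall>T \<in> RPP12 (skew la mu) nu. \<forall>(b, a) \<in> set (component_columns la mu nu).
        pure_count 1 (skew la mu) (f T) b a = pure_count 2 (skew la mu) T b a \<and>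
        pure_count 2 (skew la mu) (f T) b a = pure_count 1 (skew la mu) T b a)"

definition involution_on :: "'a set \<Rightarrow> ('a \<Rightarrow> 'a) \<Rightarrow> bool" where
  "involution_on X f \<longleftrightarrow> f \<in> X \<rightarrow> X \<and> (\<forall>x\<in>X. f (f x) = x)"

end

theory Submission
  imports Defs
begin

text \<open>A 12-table is recorded by its thresholds: \<open>c j\<close> is the row of the first 2 in column \<open>j\<close> (one below
  the bottom cell if the column is 1-pure). Since consecutive columns share a row, a descent is just
  \<open>c k < c (k + 1)\<close>, so 12-rpps are the weakly decreasing threshold functions.

  Everything rests on the fact that a 12-rpp is determined by its seplist together with the numbers
  of 1-pure and 2-pure columns in each component. In a 12-rpp, a 2-pure column followed by a 1-pure
  column with only mixed columns in between makes the interval in between tight; so within a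
  component all 1-pure columns precede all 2-pure ones. A mixed column left of a 1-pure one sits at
  the right end of the support of its entry, and symmetrically for 2-pure columns, which fixes the
  positions of the pure columns.

  A tight interval consists of mixed columns only, so a resolution never moves a pure column out of
  its component. Hence all normal forms of a benign table have the same seplist and the same counts,
  and agree: \<open>norm\<close> is well-defined without a confluence argument. As \<open>flip\<close> exchanges the counts,
  \<open>B\<close> exchanges them too; \<open>B \<circ> B\<close> and any competitor \<open>f\<close> are then identified by their counts.\<close>

section \<open>Cut sequences\<close>

text \<open>Recursive form of \<open>cut_sequence\<close>, made for list induction: the right end is
  a parameter and the left end is free, so a tail is again an instance. Strictness of a pair is
  demanded from its predecessor, and only if a successor exists; this leaves the first and the last
  pair weak.\<close>

fun cut :: "int \<Rightarrow> (int \<times> int) list \<Rightarrow> bool" where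
  "cut e [] \<longleftrightarrow> False"
| "cut e [(b, a)] \<longleftrightarrow> b \<le> a \<and> a = e"
| "cut e ((b, a) # (b', a') # cs) \<longleftrightarrow>
     b \<le> a \<and> a < b' \<and> (cs \<noteq> [] \<longrightarrow> b' < a') \<and> cut e ((b', a') # cs)"

text \<open>The intervals between consecutive components, which are the ones required to be
  tight.\<close>

definition gaps :: "(int \<times> int) list \<Rightarrow> (int \<times> int) set" where
  "gaps cs = {(snd (cs ! k), fst (cs ! Suc k)) | k. Suc k < length cs}"

lemma gaps_simps [simp]:
  "gaps [] = {}" "gaps [x] = {}"
  "gaps (x # y # cs) = insert (snd x, fst y) (gaps (y # cs))"
proof -
  show "gaps (x # y # cs) = insert (snd x, fst y) (gaps (y # cs))" (is "?L = ?R")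
  proof (intro subset_antisym subsetI)
    fix z assume "z \<in> ?L"
    then obtain k where "z = (snd ((x # y # cs) ! k), fst ((x # y # cs) ! Suc k))"
      "Suc k < length (x # y # cs)" by (auto simp: gaps_def)
    then show "z \<in> ?R" by (cases k) (auto simp: gaps_def)
  next
    fix z assume "z \<in> ?R"
    then consider "z = (snd x, fst y)" | k where "Suc k < length (y # cs)"
      "z = (snd ((y # cs) ! k), fst ((y # cs) ! Suc k))" by (auto simp: gaps_def)
    then show "z \<in> ?L"
    proof cases
      case 1
      then show ?thesis unfolding gaps_def by (intro CollectI exI[of _ 0]) auto
    next
      case (2 k)
      then show ?thesis unfolding gaps_def by (intro CollectI exI[of _ "Suc k"]) auto
    qed
  qed
qed (auto simp: gaps_def)

lemma cut_union_simps [simp]: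
  "cut_union [] = {}" "cut_union ((b, a) # cs) = {b..<a} \<union> cut_union cs"
  by (auto simp: cut_union_def)

lemma cut_iff:
  "cut e cs \<longleftrightarrow> cs \<noteq> [] \<and> snd (last cs) = e \<and>
     (\<forall>k < length cs. fst (cs ! k) \<le> snd (cs ! k)) \<and>
     (\<forall>k. 0 < k \<and> k + 1 < length cs \<longrightarrow> fst (cs ! k) < snd (cs ! k)) \<and>
     (\<forall>k. k + 1 < length cs \<longrightarrow> snd (cs ! k) < fst (cs ! (k + 1)))"
proof (induction e cs rule: cut.induct)
  case (3 e b a b' a' cs)
  \<comment> \<open>Prepending \<open>x\<close> moves \<open>y\<close> from the exempt index 0 to
    index 1, where it must be strict exactly when something follows it.\<close>
  have pos: "(\<forall>k. 0 < k \<and> Suc k < length (x # y # cs) \<longrightarrow> P k) \<longleftrightarrow>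
     (cs \<noteq> [] \<longrightarrow> P 1) \<and> (\<forall>k. 0 < k \<and> Suc k < length (y # cs) \<longrightarrow> P (Suc k))" for P x y
  proof (intro iffI conjI allI impI)
    fix k assume *: "(cs \<noteq> [] \<longrightarrow> P 1) \<and> (\<forall>k. 0 < k \<and> Suc k < length (y # cs) \<longrightarrow> P (Suc k))"
      and k: "0 < k \<and> Suc k < length (x # y # cs)"
    then show "P k" by (cases k; cases "k - 1") (auto simp: gr0_conv_Suc)
  qed auto
  show ?case
    unfolding cut.simps 3 Suc_eq_plus1[symmetric] pos
    by (simp add: All_less_Suc2) blast
qed auto

lemma cut_sequence_iff: "cut_sequence m cs \<longleftrightarrow> cut (int m + 1) cs \<and> fst (hd cs) = 1"
  unfolding cut_sequence_def cut_iff by blast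

lemma tight_cuts_iff:
  "tight_cuts S m nu cs \<longleftrightarrow> cut_sequence m cs \<and>
     (\<forall>(x, y) \<in> gaps cs. int (length (sub_within S nu x y)) = y - x)"
  unfolding tight_cuts_def gaps_def by auto

lemma cut_union_bounds: "cut e cs \<Longrightarrow> fst (hd cs) \<le> e \<and> cut_union cs \<subseteq> {fst (hd cs)..<e}"
  by (induction e cs rule: cut.induct) fastforce+

lemma cut_gap:
  "cut e cs \<Longrightarrow> (x, y) \<in> gaps cs \<Longrightarrow>
     fst (hd cs) \<le> x \<and> x < y \<and> y \<le> e \<and> {x..<y} \<inter> cut_union cs = {}"
proof (induction e cs rule: cut.induct)
  case (3 e b a b' a' cs)
  have "b' \<le> e" "cut_union ((b', a') # cs) \<subseteq> {b'..<e}"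
    using cut_union_bounds[of e "(b', a') # cs"] 3(2) by auto
  then show ?case using 3 by (fastforce simp del: cut_union_simps simp: cut_union_simps(2)[of b])
qed auto

lemma cut_cover:
  "cut e cs \<Longrightarrow> z \<in> {fst (hd cs)..<e} \<Longrightarrow>
     z \<in> cut_union cs \<or> (\<exists>x y. (x, y) \<in> gaps cs \<and> z \<in> {x..<y})"
proof (induction e cs rule: cut.induct)
  case (3 e b a b' a' cs)
  consider "z < a" | "a \<le> z" "z < b'" | "b' \<le> z" by linarith
  then show ?case
  proof cases
    case 3
    then show ?thesis using "3.IH" "3.prems" by (simp del: cut_union_simps add: cut_union_simps(2)[of b]) blast
  qed (use "3.prems" in auto)
qed auto

text \<open>A pair between two gaps is strict, so no two gaps touch: gaps are maximal runs outside
  \<open>cut_union\<close>.\<close>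

lemma cut_gap_ends:
  "cut e cs \<Longrightarrow> (x, y) \<in> gaps cs \<Longrightarrow>
     (x = fst (hd cs) \<or> x - 1 \<in> cut_union cs) \<and> (y = e \<or> y \<in> cut_union cs)"
proof (induction e cs rule: cut.induct)
  case (3 e b a b' a' cs)
  show ?case
  proof (cases "(x, y) \<in> gaps ((b', a') # cs)")
    case True
    then have "cs \<noteq> []" by auto
    then have "b' \<in> cut_union ((b', a') # cs)" "b' < a'" using 3(2) by auto
    moreover have "x \<noteq> b'"
      using cut_gap[of e "(b', a') # cs" x y] True 3(2) calculation by auto
    ultimately show ?thesis using 3 True by auto
  next
    case False
    then have "x = a" "y = b'" using 3(3) by auto
    moreover have "b' = e \<or> b' < a'" using 3(2) by (cases cs) auto
    ultimately show ?thesis using 3(2) by auto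
  qed
qed auto

lemma cut_member_ends:
  "cut e cs \<Longrightarrow> (x, y) \<in> set cs \<Longrightarrow>
     fst (hd cs) \<le> x \<and> x \<le> y \<and> y \<le> e \<and>
     (x = fst (hd cs) \<or> (\<exists>w. (w, x) \<in> gaps cs)) \<and> (y = e \<or> (\<exists>w. (y, w) \<in> gaps cs))"
proof (induction e cs rule: cut.induct)
  case (3 e b a b' a' cs)
  have "b' \<le> e" using cut_union_bounds[of e "(b', a') # cs"] 3(2) by auto
  then show ?case using 3 by fastforce
qed auto

text \<open>A walk from left to right, alternating between components and gaps. It later carries an
  equality of mixed-column counts to every component end.\<close>

lemma cut_propagate:
  "cut e cs \<Longrightarrow> Q (fst (hd cs)) \<Longrightarrow> \<forall>(x, y) \<in> set cs. Q x \<longrightarrow> Q y \<Longrightarrow>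
     \<forall>(x, y) \<in> gaps cs. Q x \<longrightarrow> Q y \<Longrightarrow> \<forall>(x, y) \<in> set cs. Q x \<and> Q y"
  by (induction e cs rule: cut.induct) auto

text \<open>By maximality of the gaps the pairs can be read off the union: the first pair stops at
  the first missing point, and the second starts where the union resumes, or at
  \<open>e\<close>.\<close>

lemma cut_unique:
  "cut e cs \<Longrightarrow> cut e cs' \<Longrightarrow> fst (hd cs) = fst (hd cs') \<Longrightarrow> cut_union cs = cut_union cs' \<Longrightarrow> cs = cs'"
proof (induction e cs arbitrary: cs' rule: cut.induct)
  case (2 e b a)
  show ?case
  proof (cases "gaps cs' = {}")
    case True
    then obtain a' where "cs' = [(b, a')]"
      using 2 by (cases "(e, cs')" rule: cut.cases) auto
    then show ?thesis using 2 by auto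
  next
    case False
    then obtain x y where "(x, y) \<in> gaps cs'" by auto
    then have "x \<in> {b..<e}" "x \<notin> cut_union cs'" using cut_gap[OF 2(2), of x y] 2(3) by auto
    then show ?thesis using 2 by auto
  qed
next
  case (3 e b a b' a' cs)
  have bnd: "b' \<le> e" "cut_union ((b', a') # cs) \<subseteq> {b'..<e}"
    using cut_union_bounds[of e "(b', a') # cs"] 3(2) by auto
  let ?V = "cut_union ((b, a) # (b', a') # cs)"
  have V: "{b..<a} \<subseteq> ?V" "a < e" "a \<notin> ?V" "{a..<b'} \<inter> ?V = {}" "b' = e \<or> b' \<in> ?V"
    using cut_gap[OF 3(2), of a b'] cut_gap_ends[OF 3(2), of a b'] by auto
  obtain a1 cs1 where cs1: "cs' = (b, a1) # cs1" using 3 by (cases cs') auto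
  have "cs1 \<noteq> []"
  proof
    assume "cs1 = []"
    then have "a \<in> cut_union cs'" using V(2) 3(2,3) cs1 by auto
    then show False using V(3)[unfolded 3(5)] by blast
  qed
  then obtain b2 a2 cs2 where cs': "cs' = (b, a1) # (b2, a2) # cs2" using cs1 by (cases cs1) auto
  have bnd': "b2 \<le> e" "cut_union ((b2, a2) # cs2) \<subseteq> {b2..<e}"
    using cut_union_bounds[of e "(b2, a2) # cs2"] 3(3) cs' by auto
  have V': "{b..<a1} \<subseteq> ?V" "a1 \<notin> ?V" "{a1..<b2} \<inter> ?V = {}" "b2 = e \<or> b2 \<in> ?V" "b \<le> a1" "a1 < b2"
    using cut_gap[OF 3(3), of a1 b2] cut_gap_ends[OF 3(3), of a1 b2] 3(3) unfolding 3(5) cs' by auto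
  have "b \<le> a" "a < b'" using 3(2) by auto
  have a: "a1 = a"
    using V(1,3) V'(1,2,5) \<open>b \<le> a\<close> by (metis atLeastLessThan_iff linorder_neqE subsetD)
  have b: "b2 = b'"
  proof (rule ccontr)
    assume "b2 \<noteq> b'"
    then consider "b2 < b'" | "b' < b2" by linarith
    then show False
    proof cases
      case 1
      then have "b2 \<in> {a..<b'}" "b2 \<in> ?V" using V'(4,6) bnd a by auto
      then show False using V(4) by blast
    next
      case 2
      then have "b' \<in> {a1..<b2}" "b' \<in> ?V" using V(5) bnd' a \<open>a < b'\<close> by auto
      then show False using V'(3) by blast
    qed
  qed
  have "cut_union ((b', a') # cs) = ?V - {b..<a}"
    using bnd \<open>a < b'\<close> by (simp only: cut_union_simps(2)[of b]) auto
  moreover have "cut_union ((b2, a2) # cs2) = cut_union cs' - {b..<a}"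
    using bnd' V'(6) unfolding cs' a by (simp only: cut_union_simps(2)[of b]) auto
  ultimately have "cut_union ((b', a') # cs) = cut_union ((b2, a2) # cs2)" using 3(5) by simp
  then have "(b', a') # cs = (b2, a2) # cs2"
    using 3(1)[of "(b2, a2) # cs2"] 3(2,3) b cs' by auto
  then show ?case using cs' a by simp
qed auto

text \<open>The sequence is built column by column from the right. The two conjuncts about
  \<open>a\<close> record whether the leading pair is empty, which decides how the next column is
  attached.\<close>

lemma cut_exists:
  assumes "b \<le> e"
  shows "\<exists>a cs. cut e ((b, a) # cs) \<and> cut_union ((b, a) # cs) = {b..<e} - U \<and>
    (b \<in> U \<longrightarrow> a = b) \<and> (b \<notin> U \<and> b < e \<longrightarrow> b < a)"
  using assms
proof (induction "nat (e - b)" arbitrary: b)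
  case 0
  then show ?case by (intro exI[of _ b] exI[of _ "[]"]) auto
next
  case (Suc k)
  then have "b < e" "k = nat (e - (b + 1))" "b + 1 \<le> e" by linarith+
  then obtain a cs where a: "cut e ((b + 1, a) # cs)" "cut_union ((b + 1, a) # cs) = {b + 1..<e} - U"
    "b + 1 \<in> U \<longrightarrow> a = b + 1" "b + 1 \<notin> U \<and> b + 1 < e \<longrightarrow> b + 1 < a"
    using Suc(1)[of "b + 1"] by auto
  have ba: "b + 1 \<le> a" using a(1) by (cases cs) auto
  show ?case
  proof (cases "b \<in> U")
    case False
    have "cut e ((b, a) # cs)" using a(1) ba by (cases cs) auto
    moreover have "cut_union ((b, a) # cs) = insert b (cut_union ((b + 1, a) # cs))"
      using ba by auto
    moreover have "\<dots> = {b..<e} - U" unfolding a(2) using False \<open>b < e\<close> by auto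
    ultimately show ?thesis using False ba by (intro exI[of _ a] exI[of _ cs]) auto
  next
    case True
    have eq: "{b..<e} - U = {b + 1..<e} - U" using True by (auto simp: order_le_less)
    show ?thesis
    \<comment> \<open>An empty leading pair followed by a gap is moved to \<open>(b, b)\<close>,
      which lengthens that gap. Otherwise a new gap \<open>[b, b + 1)\<close> is opened behind a new
      empty pair.\<close>
    proof (cases "b + 1 \<in> U \<and> cs \<noteq> []")
      case True
      then have "cut e ((b, b) # cs)" using a(1,3) by (cases cs) auto
      moreover have "cut_union ((b, b) # cs) = {b..<e} - U"
        unfolding eq a(2)[symmetric] using True a(3) by auto
      ultimately show ?thesis using \<open>b \<in> U\<close> by blast
    next
      case False
      have "b + 1 < a" if "cs \<noteq> []"
        using False a(1,4) that cut_union_bounds[of e cs] by (cases cs) auto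
      then have "cut e ((b, b) # (b + 1, a) # cs)" using a(1) by auto
      moreover have "cut_union ((b, b) # (b + 1, a) # cs) = {b..<e} - U"
        unfolding eq a(2)[symmetric] by auto
      ultimately show ?thesis using \<open>b \<in> U\<close> by blast
    qed
  qed
qed

section \<open>12-tables as threshold functions\<close>

text \<open>All that is kept of the skew shape: columns are intervals of rows whose two ends weakly
  decrease. Connectedness survives as \<open>overlap\<close>, which puts row \<open>t j\<close> into
  both columns \<open>j\<close> and \<open>Suc j\<close>.\<close>

locale column_shape =
  fixes S :: "cell set" and n :: nat and t d :: "nat \<Rightarrow> nat"
  assumes mem_S: "(i, j) \<in> S \<longleftrightarrow> 1 \<le> j \<and> j \<le> n \<and> t j \<le> i \<and> i \<le> d j"
    and t_le_d: "1 \<le> j \<Longrightarrow> j \<le> n \<Longrightarrow> t j \<le> d j"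
    and t_Suc: "1 \<le> j \<Longrightarrow> j < n \<Longrightarrow> t (Suc j) \<le> t j"
    and d_Suc: "1 \<le> j \<Longrightarrow> j < n \<Longrightarrow> d (Suc j) \<le> d j"
    and overlap: "1 \<le> j \<Longrightarrow> j < n \<Longrightarrow> t j \<le> d (Suc j)"
begin

definition valid :: "(nat \<Rightarrow> nat) \<Rightarrow> bool" where
  "valid c \<longleftrightarrow> (\<forall>j. 1 \<le> j \<and> j \<le> n \<longrightarrow> t j \<le> c j \<and> c j \<le> Suc (d j))"

definition tab :: "(nat \<Rightarrow> nat) \<Rightarrow> table" where
  "tab c = restrict (\<lambda>(i, j). if i < c j then 1 else 2) S"

definition mix :: "(nat \<Rightarrow> nat) \<Rightarrow> nat \<Rightarrow> bool" where
  "mix c j \<longleftrightarrow> 1 \<le> j \<and> j \<le> n \<and> t j < c j \<and> c j \<le> d j"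

definition one :: "(nat \<Rightarrow> nat) \<Rightarrow> nat \<Rightarrow> bool" where
  "one c j \<longleftrightarrow> 1 \<le> j \<and> j \<le> n \<and> c j = Suc (d j)"

definition two :: "(nat \<Rightarrow> nat) \<Rightarrow> nat \<Rightarrow> bool" where
  "two c j \<longleftrightarrow> 1 \<le> j \<and> j \<le> n \<and> c j = t j"

definition anti :: "(nat \<Rightarrow> nat) \<Rightarrow> bool" where
  "anti c \<longleftrightarrow> (\<forall>k. 1 \<le> k \<and> k < n \<longrightarrow> c (Suc k) \<le> c k)"

text \<open>The seplist in terms of thresholds; the \<open>- 1\<close> is there because a seplist
  records the row of the last 1, whereas \<open>c j\<close> is the row of the first 2.\<close>

definition entries :: "(nat \<Rightarrow> nat) \<Rightarrow> nat list" where
  "entries c = map (\<lambda>j. c j - 1) (filter (mix c) [1..<Suc n])"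

lemma antitone_from_step:
  assumes "\<And>k. 1 \<le> k \<Longrightarrow> k < n \<Longrightarrow> f (Suc k) \<le> (f k :: nat)" "1 \<le> i" "i \<le> j" "j \<le> n"
  shows "f j \<le> f i"
  using assms(3,4)
proof (induction j rule: dec_induct)
  case (step m)
  then show ?case using assms(1)[of m] assms(2) by fastforce
qed simp

lemmas t_mono = antitone_from_step[of t, OF t_Suc]
lemmas d_mono = antitone_from_step[of d, OF d_Suc]

lemma anti_mono: "anti c \<Longrightarrow> 1 \<le> i \<Longrightarrow> i \<le> j \<Longrightarrow> j \<le> n \<Longrightarrow> c j \<le> c i"
  using antitone_from_step[of c i j] by (auto simp: anti_def)

lemma validD: "valid c \<Longrightarrow> 1 \<le> j \<Longrightarrow> j \<le> n \<Longrightarrow> t j \<le> c j \<and> c j \<le> Suc (d j)"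
  by (simp add: valid_def)

lemma column_cases:
  assumes "valid c" "1 \<le> j" "j \<le> n"
  shows "one c j \<and> \<not> two c j \<and> \<not> mix c j \<or> \<not> one c j \<and> two c j \<and> \<not> mix c j \<or>
    \<not> one c j \<and> \<not> two c j \<and> mix c j"
  using validD[OF assms] t_le_d[OF assms(2,3)] assms(2,3) unfolding one_def two_def mix_def by auto

lemma tab_apply: "1 \<le> j \<Longrightarrow> j \<le> n \<Longrightarrow> t j \<le> i \<Longrightarrow> i \<le> d j \<Longrightarrow> tab c (i, j) = (if i < c j then 1 else 2)"
  by (simp add: tab_def mem_S)

lemma tab_eq_1: "(i, j) \<in> S \<Longrightarrow> tab c (i, j) = 1 \<longleftrightarrow> i < c j"
  and tab_eq_2: "(i, j) \<in> S \<Longrightarrow> tab c (i, j) = 2 \<longleftrightarrow> c j \<le> i"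
  by (simp_all add: tab_def)

lemma tab_cong: "(\<And>j. 1 \<le> j \<Longrightarrow> j \<le> n \<Longrightarrow> c j = c' j) \<Longrightarrow> tab c = tab c'"
  unfolding tab_def by (rule ext) (auto simp: mem_S restrict_def)

lemma table12_tab: "table12 S (tab c)"
  unfolding table12_def by (auto simp: tab_def mem_S PiE_def extensional_def)

lemma table12_obtain:
  assumes "table12 S T"
  obtains c where "valid c" "T = tab c"
proof -
  \<comment> \<open>The bound \<open>t j\<close> makes a 2-pure column yield exactly
    \<open>t j\<close>. A 1-pure column yields \<open>Suc (d j)\<close>, where the condition on the
    2's is vacuous.\<close>
  define c where "c = (\<lambda>j. LEAST r. t j \<le> r \<and> (\<forall>i. r \<le> i \<and> i \<le> d j \<longrightarrow> T (i, j) = 2))"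
  have T: "T \<in> S \<rightarrow>\<^sub>E {1, 2}"
    and mono: "\<And>i i' j. (i, j) \<in> S \<Longrightarrow> (i', j) \<in> S \<Longrightarrow> i \<le> i' \<Longrightarrow> T (i, j) \<le> T (i', j)"
    using assms by (auto simp: table12_def)
  have val: "T (i, j) = 1 \<or> T (i, j) = 2" if "(i, j) \<in> S" for i j
    using T that by (auto simp: PiE_def Pi_def)
  have c: "t j \<le> c j \<and> (\<forall>i. c j \<le> i \<and> i \<le> d j \<longrightarrow> T (i, j) = 2)"
    and c_le: "c j \<le> Suc (d j)" if j: "1 \<le> j" "j \<le> n" for j
  proof -
    have *: "t j \<le> Suc (d j) \<and> (\<forall>i. Suc (d j) \<le> i \<and> i \<le> d j \<longrightarrow> T (i, j) = 2)"
      using t_le_d[OF j] by auto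
    show "t j \<le> c j \<and> (\<forall>i. c j \<le> i \<and> i \<le> d j \<longrightarrow> T (i, j) = 2)"
      unfolding c_def by (rule LeastI) (rule *)
    show "c j \<le> Suc (d j)"
      unfolding c_def by (rule Least_le) (rule *)
  qed
  have "T x = tab c x" for x
  proof (cases "x \<in> S")
    case False
    then show ?thesis using T by (cases x) (auto simp: tab_def PiE_def extensional_def)
  next
    case True
    obtain i j where x: "x = (i, j)" by force
    have ij: "1 \<le> j" "j \<le> n" "t j \<le> i" "i \<le> d j" using True x by (auto simp: mem_S)
    have "T (i, j) = 1" if "i < c j"
    proof (rule ccontr)
      assume "T (i, j) \<noteq> 1"
      then have "T (i, j) = 2" using val True x by blast
      then have "T (i', j) = 2" if "i \<le> i'" "i' \<le> d j" for i'
        using mono[of i j i'] val[of i' j] that ij by (auto simp: mem_S)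
      then have "c j \<le> i" unfolding c_def using ij by (intro Least_le) auto
      then show False using that by simp
    qed
    then show ?thesis using c[OF ij(1,2)] ij by (auto simp: x tab_apply)
  qed
  moreover have "valid c" unfolding valid_def using c c_le by blast
  ultimately show ?thesis using that by blast
qed

lemma pure_1_tab: "valid c \<Longrightarrow> pure 1 S (tab c) j \<longleftrightarrow> one c j"
  using validD[of c j] t_le_d[of j] unfolding pure_def one_def mem_S
  by (fastforce simp: tab_apply split: if_splits)

lemma pure_2_tab: "valid c \<Longrightarrow> pure 2 S (tab c) j \<longleftrightarrow> two c j"
  using validD[of c j] t_le_d[of j] unfolding pure_def two_def mem_S
  by (fastforce simp: tab_apply split: if_splits)

lemma mixed_tab: "valid c \<Longrightarrow> mixed S (tab c) j \<longleftrightarrow> mix c j"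
proof
  assume "mixed S (tab c) j"
  then obtain i i' where "(i, j) \<in> S" "tab c (i, j) = 1" "(i', j) \<in> S" "tab c (i', j) = 2"
    unfolding mixed_def by blast
  then show "mix c j"
    using tab_eq_1[of i j c] tab_eq_2[of i' j c] by (simp add: mix_def mem_S)
next
  assume "mix c j"
  then show "mixed S (tab c) j" unfolding mixed_def mix_def mem_S
    by (intro conjI exI[of _ "t j"] exI[of _ "c j"]) (auto simp: tab_apply)
qed

lemma sep_tab: "mix c j \<Longrightarrow> sep S (tab c) j = c j"
  unfolding sep_def mix_def
  by (intro Least_equality) (auto simp: mem_S tab_apply split: if_splits)

text \<open>If \<open>c k < c (Suc k)\<close>, then row \<open>c k\<close> meets both columns, and
  it shows a 2 on the left and a 1 on the right.\<close>

lemma descent_tab: "valid c \<Longrightarrow> descent S (tab c) k \<longleftrightarrow> 1 \<le> k \<and> k < n \<and> c k < c (Suc k)"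
proof
  assume "descent S (tab c) k"
  then obtain r where "1 \<le> k" "(r, k) \<in> S" "(r, Suc k) \<in> S" "tab c (r, k) = 2"
    "tab c (r, Suc k) = 1" unfolding descent_def Suc_eq_plus1 by blast
  then show "1 \<le> k \<and> k < n \<and> c k < c (Suc k)"
    using tab_eq_2[of r k c] tab_eq_1[of r "Suc k" c] by (simp add: mem_S)
next
  assume "valid c" and k: "1 \<le> k \<and> k < n \<and> c k < c (Suc k)"
  then have "t k \<le> c k" "c k \<le> d (Suc k)" "d (Suc k) \<le> d k" "t (Suc k) \<le> t k"
    using validD[of c k] validD[of c "Suc k"] d_Suc[of k] t_Suc[of k] by auto
  then show "descent S (tab c) k"
    unfolding descent_def using k by (intro conjI exI[of _ "c k"]) (auto simp: mem_S tab_apply)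
qed

lemma rpp12_tab:
  assumes "valid c"
  shows "rpp12 S (tab c) \<longleftrightarrow> anti c"
proof
  assume rpp: "rpp12 S (tab c)"
  show "anti c" unfolding anti_def
  proof (intro allI impI)
    fix k assume k: "1 \<le> k \<and> k < n"
    show "c (Suc k) \<le> c k"
    proof (rule ccontr)
      assume "\<not> c (Suc k) \<le> c k"
      then have "descent S (tab c) k" using descent_tab[OF assms] k by auto
      then obtain r where r: "(r, k) \<in> S" "(r, Suc k) \<in> S" "tab c (r, k) = 2"
        "tab c (r, Suc k) = 1" unfolding descent_def Suc_eq_plus1 by blast
      have "tab c (r, k) \<le> tab c (r, Suc k)"
        using rpp r(1,2) unfolding rpp12_def by (meson le_SucI order_refl)
      then show False using r by simp
    qed
  qed
next
  assume "anti c"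
  then show "rpp12 S (tab c)"
    unfolding rpp12_def using anti_mono[of c] table12_tab
    by (fastforce simp: mem_S tab_apply)
qed

lemma benign_tab:
  "valid c \<Longrightarrow> benign S (tab c) \<longleftrightarrow> (\<forall>k l. k < l \<and> mix c k \<and> mix c l \<longrightarrow> c l \<le> c k)"
  unfolding benign_def using table12_tab by (auto simp: mixed_tab sep_tab)

lemma sep_cells_tab: "valid c \<Longrightarrow> sep_cells S (tab c) = (\<lambda>j. (c j - 1, j)) ` Collect (mix c)"
proof (intro subset_antisym subsetI)
  fix x assume "x \<in> sep_cells S (tab c)"
  then obtain i j where x: "x = (i, j)" "(i, j) \<in> S" "tab c (i, j) = 1"
    "(Suc i, j) \<in> S" "tab c (Suc i, j) = 2" unfolding sep_cells_def Suc_eq_plus1 by blast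
  then have "mix c j" "i = c j - 1"
    using tab_eq_1[of i j c] tab_eq_2[of "Suc i" j c] by (auto simp: mem_S mix_def)
  then show "x \<in> (\<lambda>j. (c j - 1, j)) ` Collect (mix c)" using x by auto
next
  fix x assume "x \<in> (\<lambda>j. (c j - 1, j)) ` Collect (mix c)"
  then obtain j where "x = (c j - 1, j)" "mix c j" by auto
  then show "x \<in> sep_cells S (tab c)"
    by (auto simp: sep_cells_def mem_S tab_apply mix_def)
qed

lemma seplist_tab:
  assumes "valid c"
  shows "seplist S (tab c) = entries c"
proof -
  have "snd ` sep_cells S (tab c) = set (filter (mix c) [1..<Suc n])"
    unfolding sep_cells_tab[OF assms] by (auto simp: mix_def image_image)
  moreover have "sorted_list_of_set (set (filter (mix c) [1..<Suc n])) = filter (mix c) [1..<Suc n]"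
    by (intro linorder_class.sorted_list_of_set.idem_if_sorted_distinct sorted_wrt_filter)
      (auto simp del: upt_Suc)
  moreover have "(THE i. (i, j) \<in> sep_cells S (tab c)) = c j - 1" if "mix c j" for j
    unfolding sep_cells_tab[OF assms] using that by (intro the_equality) auto
  ultimately show ?thesis unfolding seplist_def entries_def by (simp del: upt_Suc)
qed

section \<open>Flipping pure columns\<close>

definition flipped :: "(nat \<Rightarrow> nat) \<Rightarrow> nat \<Rightarrow> nat" where
  "flipped c j = (if c j = t j then Suc (d j) else if c j = Suc (d j) then t j else c j)"

lemma valid_flipped: "valid c \<Longrightarrow> valid (flipped c)"
  using t_le_d by (fastforce simp: valid_def flipped_def)

lemma flip_tab: "valid c \<Longrightarrow> flip S (tab c) = tab (flipped c)"
proof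
  fix x :: cell assume c: "valid c"
  obtain i j where x: "x = (i, j)" by force
  show "flip S (tab c) x = tab (flipped c) x"
  proof (cases "x \<in> S")
    case True
    then show ?thesis
      using t_le_d[of j] unfolding x flip_def
      by (auto simp: pure_1_tab[OF c, unfolded One_nat_def] pure_2_tab[OF c] one_def two_def mem_S tab_apply flipped_def)
  qed (simp add: flip_def tab_def)
qed

lemma one_flipped: "one (flipped c) = two c" and two_flipped: "two (flipped c) = one c"
  and mix_flipped: "mix (flipped c) = mix c"
  using t_le_d by (fastforce simp: one_def two_def mix_def flipped_def fun_eq_iff)+

lemma entries_flipped: "entries (flipped c) = entries c"
  unfolding entries_def mix_flipped by (auto simp: flipped_def mix_def)

lemma benign_flipped: "valid c \<Longrightarrow> anti c \<Longrightarrow> benign S (tab (flipped c))"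
  using anti_mono[of c]
  by (auto simp: benign_tab valid_flipped mix_flipped) (auto simp: mix_def flipped_def)

section \<open>Resolution of descents\<close>

definition resolve_step :: "nat \<Rightarrow> (nat \<Rightarrow> nat) \<Rightarrow> (nat \<Rightarrow> nat) \<Rightarrow> bool" where
  "resolve_step k p q \<longleftrightarrow> 1 \<le> k \<and> k < n \<and> (\<forall>j. 1 \<le> j \<and> j \<le> n \<and> j \<noteq> k \<and> j \<noteq> Suc k \<longrightarrow> q j = p j) \<and>
     (mix p k \<and> one p (Suc k) \<and> one q k \<and> mix q (Suc k) \<and> q (Suc k) = p k \<or>
      two p k \<and> mix p (Suc k) \<and> mix q k \<and> q k = p (Suc k) \<and> two q (Suc k) \<or>
      two p k \<and> one p (Suc k) \<and> one q k \<and> two q (Suc k))"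

lemma threshold_eq:
  assumes "valid p" "valid q" "1 \<le> j" "j \<le> n" "\<And>i. (i, j) \<in> S \<Longrightarrow> tab p (i, j) = tab q (i, j)"
  shows "p j = q j"
proof -
  have "i < p j \<longleftrightarrow> i < q j" if "t j \<le> i" "i \<le> d j" for i
    using assms(3,4) assms(5)[of i] tab_eq_1[of i j p] tab_eq_1[of i j q] that by (simp add: mem_S)
  moreover have "t j \<le> p j" "t j \<le> q j" "p j \<le> Suc (d j)" "q j \<le> Suc (d j)"
    using assms by (auto simp: validD)
  ultimately show ?thesis by (metis le_Suc_eq less_le_not_le linorder_neqE_nat order_le_less_trans
      not_less_eq_eq less_Suc_eq_le)
qed

lemma resolves_tab:
  assumes "valid p" "valid q" "resolves S k (tab p) (tab q)"
  shows "resolve_step k p q"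
proof -
  have k: "1 \<le> k" "k < n"
    using assms(3) descent_tab[OF assms(1)] by (auto simp: resolves_def)
  have "q j = p j" if "1 \<le> j" "j \<le> n" "j \<noteq> k" "j \<noteq> Suc k" for j
    using assms(3) that unfolding resolves_def Suc_eq_plus1[symmetric]
    by (intro threshold_eq[OF assms(2,1)]) blast+
  moreover have "mix p k \<and> one p (Suc k) \<and> one q k \<and> mix q (Suc k) \<and> q (Suc k) = p k \<or>
      two p k \<and> mix p (Suc k) \<and> mix q k \<and> q k = p (Suc k) \<and> two q (Suc k) \<or>
      two p k \<and> one p (Suc k) \<and> one q k \<and> two q (Suc k)"
    using assms(3) unfolding resolves_def Suc_eq_plus1[symmetric]
      pure_1_tab[OF assms(1)] pure_2_tab[OF assms(1)] mixed_tab[OF assms(1)]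
      pure_1_tab[OF assms(2)] pure_2_tab[OF assms(2)] mixed_tab[OF assms(2)]
    by (elim conjE disjE) (simp_all add: sep_tab)
  ultimately show ?thesis using k unfolding resolve_step_def by blast
qed

text \<open>As far as column types go, all three kinds of resolution are the transposition
  \<open>s\<close> of the two columns, so counting arguments can forget thresholds.\<close>

lemma resolve_step_swaps:
  assumes "resolve_step k p q"
  defines "s \<equiv> id(k := Suc k, Suc k := k)"
  shows "one q j = one p (s j)" "two q j = two p (s j)" "mix q j = mix p (s j)"
proof -
  consider "j = k" | "j = Suc k" | "j \<noteq> k" "j \<noteq> Suc k" by blast
  then have "one q j = one p (s j) \<and> two q j = two p (s j) \<and> mix q j = mix p (s j)"
  proof cases
    case 3
    then show ?thesis using assms(1) by (auto simp: s_def resolve_step_def one_def two_def mix_def)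
  qed (use assms(1) t_le_d in \<open>fastforce simp: s_def resolve_step_def one_def two_def mix_def\<close>)+
  then show "one q j = one p (s j)" "two q j = two p (s j)" "mix q j = mix p (s j)" by auto
qed

lemma upt_split:
  assumes "1 \<le> k" "k < n"
  shows "[1..<Suc n] = [1..<k] @ [k, Suc k] @ [Suc (Suc k)..<Suc n]"
proof -
  have "[1..<Suc n] = [1..<k] @ [k..<Suc n]"
    using assms upt_add_eq_append[of 1 k "Suc n - k"] by simp
  also have "[k..<Suc n] = k # Suc k # [Suc (Suc k)..<Suc n]"
    using assms by (simp add: upt_conv_Cons del: upt_Suc)
  finally show ?thesis by simp
qed

text \<open>At most one of the two columns is mixed, before as well as after, and its threshold
  moves along with it. As it only passes a pure column, even the order of the list survives.\<close>

lemma entries_resolve_step: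
  assumes "resolve_step k p q"
  shows "entries q = entries p"
proof -
  have k: "1 \<le> k" "k < n" using assms by (auto simp: resolve_step_def)
  have "mix q j = mix p j" "mix p j \<Longrightarrow> q j = p j" if "j \<noteq> k" "j \<noteq> Suc k" for j
    using assms that by (auto simp: resolve_step_def mix_def)
  then have eq: "map (\<lambda>j. q j - 1) (filter (mix q) xs) = map (\<lambda>j. p j - 1) (filter (mix p) xs)"
    if "k \<notin> set xs" "Suc k \<notin> set xs" for xs
    using that by (induction xs) auto
  have not_both: "one c j \<Longrightarrow> \<not> mix c j" "two c j \<Longrightarrow> \<not> mix c j" for c j
    by (auto simp: one_def two_def mix_def)
  have "map (\<lambda>j. q j - 1) (filter (mix q) [k, Suc k]) = map (\<lambda>j. p j - 1) (filter (mix p) [k, Suc k])"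
    using assms not_both[of p] not_both[of q] by (auto simp: resolve_step_def)
  moreover have "k \<notin> set [1..<k]" "Suc k \<notin> set [1..<k]" "k \<notin> set [Suc (Suc k)..<Suc n]"
    "Suc k \<notin> set [Suc (Suc k)..<Suc n]" by auto
  ultimately show ?thesis
    unfolding entries_def upt_split[OF k] filter_append map_append using eq by metis
qed

definition count :: "((nat \<Rightarrow> nat) \<Rightarrow> nat \<Rightarrow> bool) \<Rightarrow> (nat \<Rightarrow> nat) \<Rightarrow> int \<Rightarrow> int \<Rightarrow> nat" where
  "count P c b a = card {j. b \<le> int j \<and> int j < a \<and> P c j}"

text \<open>A resolution moves a pure column by one position, so it could leave the interval only by
  crossing one of the two neighbouring columns, which stay mixed.\<close>

lemma count_resolve_step:
  assumes "resolve_step k p q"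
    and "\<And>j. int j = b - 1 \<or> int j = a \<Longrightarrow> 1 \<le> j \<Longrightarrow> j \<le> n \<Longrightarrow> mix p j \<and> mix q j"
  shows "count one q b a = count one p b a" "count two q b a = count two p b a"
proof -
  define s where "s = id(k := Suc k, Suc k := k)"
  have inv: "s (s j) = j" for j by (simp add: s_def)
  have k: "1 \<le> k" "k < n" using assms(1) by (auto simp: resolve_step_def)
  have not_both: "one c j \<Longrightarrow> \<not> mix c j" "two c j \<Longrightarrow> \<not> mix c j" for c j
    by (auto simp: one_def two_def mix_def)
  have nm: "\<not> mix p k \<or> \<not> mix q k" "\<not> mix p (Suc k) \<or> \<not> mix q (Suc k)"
    using assms(1) not_both[of p] not_both[of q] by (auto simp: resolve_step_def)
  \<comment> \<open>A column bordering the interval is mixed before and after, but neither of the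
    exchanged columns is.\<close>
  have "\<not> (int k = b - 1 \<or> int k = a)" "\<not> (int (Suc k) = b - 1 \<or> int (Suc k) = a)"
    using assms(2)[of k] assms(2)[of "Suc k"] nm k by auto
  then have closed: "b \<le> int (s j) \<and> int (s j) < a \<longleftrightarrow> b \<le> int j \<and> int j < a" for j
    by (auto simp: s_def)
  have "card {j. b \<le> int j \<and> int j < a \<and> P q j} = card {j. b \<le> int j \<and> int j < a \<and> P p j}"
    if "\<And>j. P q j = P p (s j)" for P :: "(nat \<Rightarrow> nat) \<Rightarrow> nat \<Rightarrow> bool"
    by (rule bij_betw_same_card[of s], rule bij_betwI[of _ _ _ s])
      (use closed that inv in auto)
  then show "count one q b a = count one p b a" "count two q b a = count two p b a"
    using resolve_step_swaps[OF assms(1)] unfolding count_def s_def by blast+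
qed

section \<open>Termination of resolution and existence of normal forms\<close>

definition weight :: "(nat \<Rightarrow> nat) \<Rightarrow> nat \<Rightarrow> nat" where
  "weight c j = (if one c j then 0 else if two c j then 2 else 1)"

definition disorder :: "(nat \<Rightarrow> nat) \<Rightarrow> nat" where
  "disorder c = (\<Sum>j = 1..n. (n - j) * weight c j)"

text \<open>The heavier of the two columns moves from \<open>k\<close> to \<open>Suc k\<close>. The
  coefficients there differ by one, so the sum drops by the difference of the weights.\<close>

lemma disorder_resolve_step:
  assumes "resolve_step k p q"
  shows "disorder q < disorder p"
proof -
  have k: "1 \<le> k" "k < n" using assms by (auto simp: resolve_step_def)
  note sw = resolve_step_swaps[OF assms]
  have same: "weight q j = weight p j" if "j \<noteq> k" "j \<noteq> Suc k" for j
    unfolding weight_def using sw[of j] that by simp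
  have w: "weight q k = weight p (Suc k)" "weight q (Suc k) = weight p k"
    unfolding weight_def using sw[of k] sw[of "Suc k"] by simp_all
  have less: "weight p (Suc k) < weight p k"
    using assms t_le_d[of k] t_le_d[of "Suc k"] k unfolding weight_def resolve_step_def
    by (auto simp: one_def two_def mix_def)
  have split: "disorder c = (n - k) * weight c k + (n - Suc k) * weight c (Suc k) +
      (\<Sum>j \<in> {1..n} - {k, Suc k}. (n - j) * weight c j)" for c
    unfolding disorder_def
    using k by (subst sum.subset_diff[of "{k, Suc k}"]) (auto simp: add.commute)
  have "(\<Sum>j \<in> {1..n} - {k, Suc k}. (n - j) * weight q j) =
      (\<Sum>j \<in> {1..n} - {k, Suc k}. (n - j) * weight p j)"
    by (rule sum.cong) (auto simp: same)
  moreover have "n - k = Suc (n - Suc k)" using k by simp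
  ultimately show ?thesis unfolding split w using less by simp
qed

lemma resolve_progress:
  assumes p: "valid p" and benign: "benign S (tab p)" and "\<not> anti p"
  obtains k q where "valid q" "resolves S k (tab p) (tab q)"
proof -
  obtain k where k: "1 \<le> k" "k < n" and less: "p k < p (Suc k)"
    using assms(3) by (auto simp: anti_def not_le)
  note bounds = validD[OF p, of k] validD[OF p, of "Suc k"] t_Suc[of k] d_Suc[of k] overlap[of k]
    t_le_d[of k] t_le_d[of "Suc k"] k less
  have "\<not> (mix p k \<and> mix p (Suc k))"
    using benign benign_tab[OF p] less by (meson lessI not_le)
  \<comment> \<open>A 1-pure column \<open>k\<close> has threshold
    \<open>Suc (d k) \<ge> Suc (d (Suc k))\<close>, which leaves no room for an ascent; a 2-pure
    column \<open>Suc k\<close> is excluded likewise through \<open>t\<close>. Benignity excludes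
    two mixed columns, so three cases remain.\<close>
  moreover have "\<not> one p k" "\<not> two p (Suc k)"
    using bounds by (auto simp: one_def two_def)
  ultimately consider (M1) "mix p k" "one p (Suc k)" | (2) "two p k" "mix p (Suc k)"
    | (21) "two p k" "one p (Suc k)"
    using column_cases[OF p, of k] column_cases[OF p, of "Suc k"] k by auto
  then obtain q where val: "valid q" and step: "resolve_step k p q"
  proof cases
    case M1
    have "valid (p(k := Suc (d k), Suc k := p k))" "resolve_step k p (p(k := Suc (d k), Suc k := p k))"
      using p M1 bounds by (auto simp: valid_def resolve_step_def one_def two_def mix_def)
    then show ?thesis by (rule that)
  next
    case 2
    have "valid (p(k := p (Suc k), Suc k := t (Suc k)))"
      "resolve_step k p (p(k := p (Suc k), Suc k := t (Suc k)))"
      using p 2 bounds by (auto simp: valid_def resolve_step_def one_def two_def mix_def)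
    then show ?thesis by (rule that)
  next
    case 21
    have "valid (p(k := Suc (d k), Suc k := t (Suc k)))"
      "resolve_step k p (p(k := Suc (d k), Suc k := t (Suc k)))"
      using p 21 bounds by (auto simp: valid_def resolve_step_def one_def two_def mix_def)
    then show ?thesis by (rule that)
  qed
  \<comment> \<open>For benignity of the new table: columns \<open>k\<close> and
    \<open>Suc k\<close> are not both mixed, so \<open>s\<close> keeps the order of the mixed
    columns, and thresholds travel with them.\<close>
  define s where "s = id(k := Suc k, Suc k := k)"
  have mix_q: "mix q j = mix p (s j)" for j using resolve_step_swaps(3)[OF step] by (simp add: s_def)
  have q_eq: "mix q j \<Longrightarrow> q j = p (s j)" for j
    using step by (cases "j = k"; cases "j = Suc k")
      (auto simp: s_def resolve_step_def one_def two_def mix_def)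
  have "q l \<le> q j" if "j < l" "mix q j" "mix q l" for j l
  proof -
    have "\<not> (mix p (s k) \<and> mix p (s (Suc k)))"
      using \<open>\<not> (mix p k \<and> mix p (Suc k))\<close> by (auto simp: s_def)
    then have "s j < s l" using that mix_q by (auto simp: s_def)
    then show ?thesis using benign benign_tab[OF p] mix_q that q_eq by metis
  qed
  then have "benign S (tab q)" using benign_tab[OF val] by blast
  then have "resolves S k (tab p) (tab q)"
    using step benign k less unfolding resolves_def descent_tab[OF p] Suc_eq_plus1[symmetric]
      pure_1_tab[OF p] pure_2_tab[OF p] mixed_tab[OF p]
      pure_1_tab[OF val] pure_2_tab[OF val] mixed_tab[OF val] resolve_step_def
    by (auto simp: sep_tab mem_S tab_apply)
  then show ?thesis using val that by blast
qed

lemma norm_exists: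
  assumes "valid p" "benign S (tab p)"
  shows "\<exists>Q. rpp12 S Q \<and> (\<lambda>P Q. \<exists>k. resolves S k P Q)\<^sup>*\<^sup>* (tab p) Q"
  using assms
proof (induction "disorder p" arbitrary: p rule: less_induct)
  case less
  show ?case
  proof (cases "anti p")
    case True
    then show ?thesis using rpp12_tab[OF less(2)] by blast
  next
    case False
    then obtain k q where q: "valid q" "resolves S k (tab p) (tab q)"
      using resolve_progress less by metis
    moreover have "disorder q < disorder p"
      using q less(2) by (intro disorder_resolve_step resolves_tab)
    moreover have "benign S (tab q)" using q by (simp add: resolves_def)
    ultimately obtain Q where Q: "rpp12 S Q" "(\<lambda>P Q. \<exists>k. resolves S k P Q)\<^sup>*\<^sup>* (tab q) Q"
      using less(1) by blast
    have "(\<lambda>P Q. \<exists>k. resolves S k P Q)\<^sup>*\<^sup>* (tab p) Q"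
      by (rule converse_rtranclp_into_rtranclp[OF _ Q(2)]) (use q(2) in blast)
    then show ?thesis using Q(1) by blast
  qed
qed

section \<open>Reconstructing a 12-rpp from its pure columns\<close>

text \<open>For a mixed column \<open>x\<close> this is the position, counted from 0, of its entry
  in \<open>entries c\<close>.\<close>

definition mixed_before :: "(nat \<Rightarrow> nat) \<Rightarrow> nat \<Rightarrow> nat" where
  "mixed_before c x = card {j. mix c j \<and> j < x}"

lemma finite_mix [simp]: "finite {j. mix c j \<and> P j}"
  by (rule finite_subset[of _ "{..n}"]) (auto simp: mix_def)

lemma mixed_before_add:
  "x \<le> y \<Longrightarrow> mixed_before c y = mixed_before c x + card {j. mix c j \<and> x \<le> j \<and> j < y}"
  unfolding mixed_before_def by (subst card_Un_disjoint[symmetric]) (auto intro!: arg_cong[of _ _ card])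

lemma mixed_before_mono: "x \<le> y \<Longrightarrow> mixed_before c x \<le> mixed_before c y"
  using mixed_before_add by simp

lemma mixed_before_le: "x \<le> y \<Longrightarrow> mixed_before c y \<le> mixed_before c x + (y - x)"
proof -
  assume xy: "x \<le> y"
  have "card {j. mix c j \<and> x \<le> j \<and> j < y} \<le> card {x..<y}" by (intro card_mono) auto
  then show ?thesis using mixed_before_add[OF xy, of c] by simp
qed

lemma mixed_before_all:
  assumes "x \<le> y" "\<And>j. x \<le> j \<Longrightarrow> j < y \<Longrightarrow> mix c j"
  shows "mixed_before c y = mixed_before c x + (y - x)"
proof -
  have "{j. mix c j \<and> x \<le> j \<and> j < y} = {x..<y}" using assms(2) by auto
  then show ?thesis using mixed_before_add[OF assms(1), of c] by simp
qed

lemma mixed_before_Suc: "mix c x \<Longrightarrow> mixed_before c (Suc x) = Suc (mixed_before c x)"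
  using mixed_before_all[of x "Suc x" c] by (simp add: le_less_Suc_eq)

lemma nth_entries:
  assumes "mix c j"
  shows "mixed_before c j < length (entries c)" "entries c ! mixed_before c j = c j - 1"
    "filter (mix c) [1..<Suc n] ! mixed_before c j = j"
proof -
  have j: "1 \<le> j" "j \<le> n" using assms by (auto simp: mix_def)
  have "mixed_before c j = card (set (filter (mix c) [1..<j]))"
    unfolding mixed_before_def by (rule arg_cong[of _ _ card]) (auto simp: mix_def)
  also have "\<dots> = length (filter (mix c) [1..<j])" by (rule distinct_card) simp
  finally have len: "mixed_before c j = length (filter (mix c) [1..<j])" .
  have "[1..<Suc n] = [1..<j] @ j # [Suc j..<Suc n]"
    using j upt_add_eq_append[of 1 j "Suc n - j"] by (simp add: upt_conv_Cons del: upt_Suc)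
  then have split: "filter (mix c) [1..<Suc n] = filter (mix c) [1..<j] @ j # filter (mix c) [Suc j..<Suc n]"
    using assms by (simp del: upt_Suc)
  show "mixed_before c j < length (entries c)" "entries c ! mixed_before c j = c j - 1"
    "filter (mix c) [1..<Suc n] ! mixed_before c j = j"
    unfolding entries_def split len by (simp_all add: nth_append del: upt_Suc)
qed

lemma length_entries: "length (entries c) = length (filter (mix c) [1..<Suc n])"
  by (simp add: entries_def)

text \<open>Mixed columns of two tables with equal entries are matched by their position in the
  list.\<close>

lemma entry_transfer:
  assumes "entries c = entries c'" "mix c' j'"
  obtains j where "mix c j" "mixed_before c j = mixed_before c' j'" "c j = c' j'"
proof -
  define w where "w = mixed_before c' j'"
  define js where "js = filter (mix c) [1..<Suc n]"
  have w: "w < length js" "entries c ! w = c' j' - 1"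
    using nth_entries[OF assms(2)] assms(1) length_entries[of c] by (simp_all add: w_def js_def)
  define j where "j = js ! w"
  have "j \<in> set js" using w j_def by simp
  then have "mix c j" unfolding js_def by (simp del: upt_Suc)
  note nth = nth_entries[OF this]
  have "distinct js" by (simp add: js_def)
  then have "mixed_before c j = w"
    using w(1) nth j_def length_entries[of c] unfolding js_def[symmetric]
    by (metis nth_eq_iff_index_eq)
  moreover from this have "c j - 1 = c' j' - 1" using nth w by simp
  \<comment> \<open>Truncated subtraction does no harm here: thresholds of mixed columns exceed
    \<open>t\<close>, hence are positive.\<close>
  then have "c j = c' j'" using \<open>mix c j\<close> assms(2) unfolding mix_def by linarith
  ultimately show ?thesis using that \<open>mix c j\<close> w_def by blast
qed

text \<open>In \<open>c'\<close> the entry of column \<open>q - 1\<close> has no room in column \<open>q\<close> or later, whereas in \<open>c\<close> the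
  pure column \<open>x\<close> would push this entry there.\<close>

lemma no_right_shift:
  assumes "anti c'" and entries: "entries c = entries c'"
    and x: "\<not> mix c x" "x < q" "mixed_before c x = mixed_before c' x"
    and run: "\<And>y. x \<le> y \<Longrightarrow> y < q \<Longrightarrow> mix c' y" and q: "one c' q"
  shows False
proof -
  have "mix c' (q - 1)" using run x by simp
  then obtain j where j: "mix c j" "mixed_before c j = mixed_before c' (q - 1)" "c j = c' (q - 1)"
    using entry_transfer[OF entries] by blast
  have "c' q \<le> c' (q - 1)" using \<open>mix c' (q - 1)\<close> q by (intro anti_mono[OF assms(1)]) (auto simp: mix_def one_def)
  \<comment> \<open>Here \<open>d q < c' q \<le> c j \<le> d j\<close>, and \<open>d\<close> is
    weakly decreasing.\<close>
  then have "j < q" using j(1,3) q d_mono[of q j] unfolding mix_def one_def by linarith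
  \<comment> \<open>In \<open>c'\<close> all columns from \<open>x\<close> to \<open>q - 2\<close>
    are mixed, which fixes the position of the entry.\<close>
  have N: "mixed_before c j = mixed_before c x + (q - 1 - x)"
    using mixed_before_all[of x "q - 1" c'] run x j(2) by simp
  consider "j < x" | "j = x" | "x < j" by linarith
  then show False
  proof cases
    case 1
    then show False using mixed_before_mono[of "Suc j" x c] mixed_before_Suc[OF j(1)] N by simp
  next
    case 3
    \<comment> \<open>As \<open>x\<close> itself is not mixed in \<open>c\<close>, fewer than
      \<open>q - 1 - x\<close> mixed columns fit between \<open>x\<close> and
      \<open>j\<close>.\<close>
    have "mixed_before c (Suc x) = mixed_before c x"
      using x(1) unfolding mixed_before_def by (intro arg_cong[of _ _ card]) (auto simp: less_Suc_eq)
    then show False using mixed_before_le[of "Suc x" j c] 3 N \<open>j < q\<close> by simp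
  qed (use j x in simp)
qed

text \<open>The mirror image, with tops of columns in place of bottoms: in \<open>c'\<close> the
  entry of column \<open>Suc q\<close> fits into no column up to \<open>q\<close>, whereas the pure
  column \<open>x\<close> of \<open>c\<close> would push it there. The counts are matched just after
  \<open>x\<close>, since the comparison runs from the right.\<close>

lemma no_left_shift:
  assumes "anti c'" and entries: "entries c = entries c'"
    and x: "\<not> mix c x" "q < x" "mixed_before c (Suc x) = mixed_before c' (Suc x)"
    and run: "\<And>y. q < y \<Longrightarrow> y \<le> x \<Longrightarrow> mix c' y" and q: "two c' q"
  shows False
proof -
  have "mix c' (Suc q)" using run x by simp
  then obtain j where j: "mix c j" "mixed_before c j = mixed_before c' (Suc q)" "c j = c' (Suc q)"
    using entry_transfer[OF entries] by blast
  have "c' (Suc q) \<le> c' q" using \<open>mix c' (Suc q)\<close> q by (intro anti_mono[OF assms(1)]) (auto simp: mix_def two_def)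
  then have "q < j" using j(1,3) q t_mono[of j q] unfolding mix_def two_def by linarith
  have "mixed_before c' (Suc x) = mixed_before c' (Suc q) + (x - q)"
    using mixed_before_all[of "Suc q" "Suc x" c'] run x by simp
  moreover have "mixed_before c (Suc x) = mixed_before c x"
    using x(1) unfolding mixed_before_def by (intro arg_cong[of _ _ card]) (auto simp: less_Suc_eq)
  ultimately have N: "mixed_before c x = mixed_before c j + (x - q)" using j x by simp
  show False
  proof (cases "j \<le> x")
    case True
    then show False using mixed_before_le[of j x c] N \<open>q < j\<close> x by simp
  next
    case False
    then show False using mixed_before_mono[of x j c] N x by simp
  qed
qed

text \<open>The situation of two 12-rpps on one component. It is symmetric in \<open>c\<close> and
  \<open>c'\<close>, so at a first or last difference either table may be taken as the one with the
  pure column.\<close>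

definition comparable :: "(nat \<Rightarrow> nat) \<Rightarrow> (nat \<Rightarrow> nat) \<Rightarrow> nat \<Rightarrow> nat \<Rightarrow> bool" where
  "comparable c c' b a \<longleftrightarrow> 1 \<le> b \<and> a \<le> Suc n \<and> valid c \<and> valid c' \<and> anti c \<and> anti c' \<and>
     entries c = entries c' \<and> mixed_before c b = mixed_before c' b \<and>
     mixed_before c a = mixed_before c' a \<and>
     (\<forall>p q. b \<le> p \<and> p < q \<and> q < a \<longrightarrow> \<not> (two c p \<and> one c q) \<and> \<not> (two c' p \<and> one c' q)) \<and>
     card {j \<in> {b..<a}. one c j} = card {j \<in> {b..<a}. one c' j} \<and>
     card {j \<in> {b..<a}. two c j} = card {j \<in> {b..<a}. two c' j}"

lemma comparable_sym: "comparable c c' b a \<Longrightarrow> comparable c' c b a"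
  by (auto simp: comparable_def)

lemma missing_element:
  assumes "finite X" "finite Y" "card X = card Y" "x \<in> X" "x \<notin> Y"
  obtains y where "y \<in> Y" "y \<notin> X"
proof -
  have "\<not> Y \<subseteq> X" using assms card_subset_eq[of X Y] by auto
  then show ?thesis using that by blast
qed

text \<open>Equal counts give \<open>c'\<close> a later 1-pure column; let \<open>q\<close> be the
  nearest. No 2-pure column precedes a 1-pure one, so \<open>c'\<close> is mixed from
  \<open>x\<close> up to \<open>q\<close>, and left of \<open>x\<close> both tables have only 1-pure
  and mixed columns, in the same places. Then \<open>no_right_shift\<close> applies.\<close>

lemma first_one_differs:
  assumes cmp: "comparable c c' b a" and x: "b \<le> x" "x < a" "one c x" "\<not> one c' x"
    and agree: "\<And>y. b \<le> y \<Longrightarrow> y < x \<Longrightarrow> one c y = one c' y"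
  shows False
proof -
  have bd: "1 \<le> b" "a \<le> Suc n" and val: "valid c" "valid c'" and anti: "anti c'"
    and ent: "entries c = entries c'" and Nb: "mixed_before c b = mixed_before c' b"
    and ord: "\<And>p q. b \<le> p \<Longrightarrow> p < q \<Longrightarrow> q < a \<Longrightarrow> \<not> (two c p \<and> one c q) \<and> \<not> (two c' p \<and> one c' q)"
    using cmp by (auto simp: comparable_def)
  have "card {j \<in> {b..<a}. one c j} = card {j \<in> {b..<a}. one c' j}"
    using cmp by (simp add: comparable_def)
  then obtain y where y: "y \<in> {b..<a}" "one c' y" "\<not> one c y"
    using missing_element[of "{j \<in> {b..<a}. one c j}" "{j \<in> {b..<a}. one c' j}" x] x by auto
  then have "x < y" using agree[of y] x by (cases "x = y") force+
  define q where "q = (LEAST q. x < q \<and> one c' q)"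
  have q: "x < q" "one c' q" "q \<le> y"
    using LeastI[of "\<lambda>q. x < q \<and> one c' q" y] Least_le[of "\<lambda>q. x < q \<and> one c' q" y] y \<open>x < y\<close>
    by (auto simp: q_def)
  then have qa: "q < a" using y by simp
  have run: "mix c' z" if "x \<le> z" "z < q" for z
  proof -
    have "\<not> one c' z" using not_less_Least[of z "\<lambda>q. x < q \<and> one c' q"] that x(4)
      by (cases "z = x") (auto simp: q_def)
    moreover have "\<not> two c' z" using ord[of z q] q qa that x by auto
    ultimately show ?thesis using column_cases[OF val(2), of z] that x bd qa by auto
  qed
  have "mix c j = mix c' j" if "b \<le> j" "j < x" for j
  proof -
    have "\<not> two c j" "\<not> two c' j" using ord[of j x] ord[of j q] that x q qa by auto
    then show ?thesis using column_cases[OF val(1), of j] column_cases[OF val(2), of j]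
        agree[of j] that x bd by auto
  qed
  then have "{j. mix c j \<and> b \<le> j \<and> j < x} = {j. mix c' j \<and> b \<le> j \<and> j < x}" by auto
  then have "mixed_before c x = mixed_before c' x"
    using Nb mixed_before_add[of b x] x by simp
  moreover have "\<not> mix c x" using x by (auto simp: mix_def one_def)
  ultimately show False using no_right_shift[OF anti ent _ q(1) _ run q(2)] by blast
qed

text \<open>The mirror image for 2-pure columns: \<open>q\<close> is the nearest one of
  \<open>c'\<close> left of \<open>x\<close>, and the mixed columns are compared from the right end
  \<open>a\<close>.\<close>

lemma last_two_differs:
  assumes cmp: "comparable c c' b a" and x: "b \<le> x" "x < a" "two c x" "\<not> two c' x"
    and agree: "\<And>y. x < y \<Longrightarrow> y < a \<Longrightarrow> two c y = two c' y"
  shows False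
proof -
  have bd: "1 \<le> b" "a \<le> Suc n" and val: "valid c" "valid c'" and anti: "anti c'"
    and ent: "entries c = entries c'" and Na: "mixed_before c a = mixed_before c' a"
    and ord: "\<And>p q. b \<le> p \<Longrightarrow> p < q \<Longrightarrow> q < a \<Longrightarrow> \<not> (two c p \<and> one c q) \<and> \<not> (two c' p \<and> one c' q)"
    using cmp by (auto simp: comparable_def)
  have "card {j \<in> {b..<a}. two c j} = card {j \<in> {b..<a}. two c' j}"
    using cmp by (simp add: comparable_def)
  then obtain y where y: "y \<in> {b..<a}" "two c' y" "\<not> two c y"
    using missing_element[of "{j \<in> {b..<a}. two c j}" "{j \<in> {b..<a}. two c' j}" x] x by auto
  then have "y < x" using agree[of y] x by (cases "x = y") force+
  define q where "q = (GREATEST q. q < x \<and> two c' q)"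
  have "q < x \<and> two c' q" unfolding q_def
    by (rule GreatestI_nat[of "\<lambda>q. q < x \<and> two c' q" y x]) (use y \<open>y < x\<close> in auto)
  moreover have q_ge: "z \<le> q" if "z < x" "two c' z" for z unfolding q_def
    by (rule Greatest_le_nat[of "\<lambda>q. q < x \<and> two c' q" z x]) (use that in auto)
  ultimately have q: "q < x" "two c' q" "b \<le> q" using y \<open>y < x\<close> by force+
  have run: "mix c' z" if "q < z" "z \<le> x" for z
  proof -
    have "\<not> two c' z" using q_ge[of z] that x(4) by (cases "z = x") auto
    moreover have "\<not> one c' z" using ord[of q z] q that x by auto
    ultimately show ?thesis using column_cases[OF val(2), of z] that x bd q by auto
  qed
  have "mix c j = mix c' j" if "Suc x \<le> j" "j < a" for j
  proof -
    have "\<not> one c j" "\<not> one c' j" using ord[of x j] ord[of q j] that x q by auto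
    then show ?thesis using column_cases[OF val(1), of j] column_cases[OF val(2), of j]
        agree[of j] that x bd by auto
  qed
  then have "{j. mix c j \<and> Suc x \<le> j \<and> j < a} = {j. mix c' j \<and> Suc x \<le> j \<and> j < a}" by auto
  then have "mixed_before c (Suc x) = mixed_before c' (Suc x)"
    using Na mixed_before_add[of "Suc x" a] x by simp
  moreover have "\<not> mix c x" using x by (auto simp: mix_def two_def)
  ultimately show False using no_left_shift[OF anti ent _ q(1) _ run q(2)] by blast
qed

lemma comparable_one_eq:
  assumes cmp: "comparable c c' b a" and "b \<le> x" "x < a"
  shows "one c x = one c' x"
proof (rule ccontr)
  assume "one c x \<noteq> one c' x"
  define P where "P y \<longleftrightarrow> b \<le> y \<and> y < a \<and> one c y \<noteq> one c' y" for y
  have "P x" using assms \<open>one c x \<noteq> one c' x\<close> by (simp add: P_def)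
  define z where "z = (LEAST y. P y)"
  have "P z" unfolding z_def by (rule LeastI) fact
  moreover have "one c y = one c' y" if "b \<le> y" "y < z" for y
    using not_less_Least[of y P] that \<open>P z\<close> by (auto simp: P_def z_def)
  ultimately show False
    using first_one_differs[OF cmp, of z] first_one_differs[OF comparable_sym[OF cmp], of z]
    unfolding P_def by blast
qed

lemma comparable_two_eq:
  assumes cmp: "comparable c c' b a" and "b \<le> x" "x < a"
  shows "two c x = two c' x"
proof (rule ccontr)
  assume "two c x \<noteq> two c' x"
  define P where "P y \<longleftrightarrow> b \<le> y \<and> y < a \<and> two c y \<noteq> two c' y" for y
  have "P x" using assms \<open>two c x \<noteq> two c' x\<close> by (simp add: P_def)
  define z where "z = (GREATEST y. P y)"
  have "P z" unfolding z_def by (rule GreatestI_nat[of P x a]) (use \<open>P x\<close> in \<open>auto simp: P_def\<close>)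
  moreover have "two c y = two c' y" if "z < y" "y < a" for y
    using Greatest_le_nat[of P y a] that \<open>P z\<close> unfolding P_def z_def
    by (metis (no_types, lifting) less_imp_le not_le order_trans)
  ultimately show False
    using last_two_differs[OF cmp, of z] last_two_differs[OF comparable_sym[OF cmp], of z]
    unfolding P_def by blast
qed

text \<open>Take a 2-pure and a 1-pure column with only mixed columns in between: their thresholds bound
  those in between, so that no support reaches either of the two.\<close>

lemma two_before_one:
  assumes c: "valid c" "anti c" and pq: "p < q" "two c p" "one c q"
  obtains x y where "p < x" "x < y" "y \<le> q"
    "\<And>j. x \<le> j \<Longrightarrow> j < y \<Longrightarrow> mix c j \<and> supp S (c j - 1) \<subseteq> {x..<y}"
proof -
  \<comment> \<open>With \<open>y\<close> the first 1-pure column after \<open>p\<close> and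
    \<open>p'\<close> the last 2-pure column before \<open>y\<close>, all columns strictly between
    \<open>p'\<close> and \<open>y\<close> are mixed.\<close>
  define y where "y = (LEAST y. p < y \<and> one c y)"
  have y: "p < y" "one c y" "y \<le> q"
    using LeastI[of "\<lambda>y. p < y \<and> one c y" q] Least_le[of "\<lambda>y. p < y \<and> one c y" q] pq
    by (auto simp: y_def)
  define p' where "p' = (GREATEST p'. p' < y \<and> two c p')"
  have p': "p' < y \<and> two c p'" unfolding p'_def
    by (rule GreatestI_nat[of "\<lambda>p'. p' < y \<and> two c p'" p y]) (use y pq in auto)
  have p'_ge: "z \<le> p'" if "z < y" "two c z" for z unfolding p'_def
    by (rule Greatest_le_nat[of "\<lambda>p'. p' < y \<and> two c p'" z y]) (use that in auto)
  have "p \<le> p'" using p'_ge pq y by blast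
  have cols: "1 \<le> p'" "y \<le> n" "c p' = t p'" "c y = Suc (d y)"
    using p' y by (auto simp: one_def two_def)
  \<comment> \<open>Were the two columns adjacent, \<open>overlap\<close> would give
    \<open>c p' = t p' \<le> d y < c y\<close>, against \<open>anti c\<close>.\<close>
  have "Suc p' \<noteq> y"
    using overlap[of p'] anti_mono[OF c(2), of p' y] cols by auto
  then have "Suc p' < y" using p' by simp
  moreover have "mix c j \<and> supp S (c j - 1) \<subseteq> {Suc p'..<y}" if j: "Suc p' \<le> j" "j < y" for j
  proof -
    have "\<not> two c j" using p'_ge[of j] j by auto
    moreover have "\<not> one c j"
      using not_less_Least[of j "\<lambda>y. p < y \<and> one c y"] j \<open>p \<le> p'\<close> by (auto simp: y_def)
    ultimately have mix: "mix c j" using column_cases[OF c(1), of j] j cols by auto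
    have le: "c j \<le> t p'" "Suc (d y) \<le> c j"
      using anti_mono[OF c(2), of p' j] anti_mono[OF c(2), of j y] j cols by auto
    have "z \<in> {Suc p'..<y}" if "z \<in> supp S (c j - 1)" for z
    proof -
      have z: "1 \<le> z" "z \<le> n" "t z < c j" "c j \<le> d z"
        using that mix by (auto simp: supp_def mem_S mix_def)
      have "\<not> z \<le> p'" using t_mono[of z p'] z le p' by (auto simp: two_def)
      moreover have "\<not> y \<le> z" using d_mono[of y z] z le y by (auto simp: one_def)
      ultimately show ?thesis by auto
    qed
    then show ?thesis using mix by blast
  qed
  ultimately show ?thesis using that[of "Suc p'" y] \<open>p \<le> p'\<close> y(3) by simp
qed

text \<open>Pure columns have a prescribed threshold; a mixed column has the same position among the
  mixed columns in both tables, hence the same entry.\<close>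

lemma threshold_determined:
  assumes "valid c" "valid c'" "entries c = entries c'"
    and "\<And>j. 1 \<le> j \<Longrightarrow> j \<le> n \<Longrightarrow> one c j = one c' j \<and> two c j = two c' j"
    and j: "1 \<le> j" "j \<le> n"
  shows "c j = c' j"
proof -
  have mix: "mix c = mix c'"
  proof
    fix k
    show "mix c k = mix c' k"
      using column_cases[OF assms(1), of k] column_cases[OF assms(2), of k] assms(4)[of k]
      by (cases "1 \<le> k \<and> k \<le> n") (auto simp: mix_def)
  qed
  show ?thesis
  proof (cases "mix c j")
    case True
    then have "c j - 1 = c' j - 1"
      using nth_entries(2)[of c j] nth_entries(2)[of c' j] assms(3)
      unfolding mix mixed_before_def by simp
    moreover have "mix c' j" using True mix by simp
    ultimately show ?thesis using True unfolding mix_def by linarith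
  next
    case False
    then show ?thesis using column_cases[OF assms(1), of j] assms(4)[of j] j
      by (auto simp: one_def two_def)
  qed
qed

section \<open>Irreducible components\<close>

definition tight :: "nat list \<Rightarrow> int \<Rightarrow> int \<Rightarrow> bool" where
  "tight nu a b \<longleftrightarrow> a < b \<and> int (length (sub_within S nu a b)) = b - a"

text \<open>As a mixed column \<open>j\<close> lies in the support of its entry, the entries with support in an
  interval come from columns in that interval; tightness leaves no room for other columns.\<close>

lemma tight_iff:
  assumes "a < b"
  shows "tight (entries c) a b \<longleftrightarrow>
    (\<forall>x \<in> {a..<b}. \<exists>j. x = int j \<and> mix c j \<and> int ` supp S (c j - 1) \<subseteq> {a..<b})"
proof -
  define J where "J = {j. mix c j \<and> int ` supp S (c j - 1) \<subseteq> {a..<b}}"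
  have "length (sub_within S (entries c) a b) =
      length (filter (\<lambda>j. int ` supp S (c j - 1) \<subseteq> {a..<b}) (filter (mix c) [1..<Suc n]))"
    by (simp add: sub_within_def entries_def filter_map comp_def del: upt_Suc)
  also have "\<dots> = card (set (filter (\<lambda>j. int ` supp S (c j - 1) \<subseteq> {a..<b}) (filter (mix c) [1..<Suc n])))"
    by (rule distinct_card[symmetric]) simp
  also have "set (filter (\<lambda>j. int ` supp S (c j - 1) \<subseteq> {a..<b}) (filter (mix c) [1..<Suc n])) = J"
    by (auto simp: J_def mix_def)
  also have "card J = card (int ` J)" by (simp add: card_image)
  finally have len: "length (sub_within S (entries c) a b) = card (int ` J)" .
  have sub: "int ` J \<subseteq> {a..<b}"
  proof
    fix x assume "x \<in> int ` J"
    then obtain j where j: "x = int j" "mix c j" "int ` supp S (c j - 1) \<subseteq> {a..<b}"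
      by (auto simp: J_def)
    have "j \<in> supp S (c j - 1)" using j(2) by (auto simp: supp_def mem_S mix_def)
    then show "x \<in> {a..<b}" using j by blast
  qed
  have "tight (entries c) a b \<longleftrightarrow> card (int ` J) = card {a..<b}"
    using assms by (auto simp: tight_def len)
  also have "\<dots> \<longleftrightarrow> int ` J = {a..<b}" using card_subset_eq[OF _ sub] by (metis finite_atLeastLessThan_int)
  also have "\<dots> \<longleftrightarrow> {a..<b} \<subseteq> int ` J" using sub by blast
  also have "\<dots> \<longleftrightarrow> (\<forall>x \<in> {a..<b}. \<exists>j. x = int j \<and> mix c j \<and> int ` supp S (c j - 1) \<subseteq> {a..<b})"
    by (auto simp: J_def)
  finally show ?thesis .
qed

lemma tight_mix:
  assumes "tight (entries c) a b" "a \<le> int j" "int j < b"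
  shows "mix c j"
proof -
  have "a < b" "int j \<in> {a..<b}" using assms by auto
  then obtain j' where "int j = int j'" "mix c j'"
    using tight_iff[of a b c] assms(1) by blast
  then show ?thesis by simp
qed

definition tight_columns :: "nat list \<Rightarrow> int set" where
  "tight_columns nu = {x. \<exists>a b. tight nu a b \<and> a \<le> x \<and> x < b}"

lemma tight_columnsI: "tight nu a b \<Longrightarrow> a \<le> x \<Longrightarrow> x < b \<Longrightarrow> x \<in> tight_columns nu"
  unfolding tight_columns_def by blast

text \<open>The first and the last column of a tight interval are mixed, hence columns of the
  shape.\<close>

lemma tight_bounds:
  assumes "tight (entries c) a b"
  shows "1 \<le> a \<and> b \<le> int n + 1"
proof -
  have ab: "a < b" using assms by (simp add: tight_def)
  then have "a \<in> {a..<b}" "b - 1 \<in> {a..<b}" by auto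
  then obtain j j' where "a = int j" "mix c j" "b - 1 = int j'" "mix c j'"
    using tight_iff[OF ab, of c] assms by meson
  then show ?thesis by (auto simp: mix_def)
qed

lemma tight_cuts_tight:
  "tight_cuts S n nu cs \<longleftrightarrow> cut (int n + 1) cs \<and> fst (hd cs) = 1 \<and> (\<forall>(x, y) \<in> gaps cs. tight nu x y)"
  unfolding tight_cuts_iff cut_sequence_iff tight_def using cut_gap[of "int n + 1" cs] by fast

definition components :: "nat list \<Rightarrow> (int \<times> int) list \<Rightarrow> bool" where
  "components nu cs \<longleftrightarrow> tight_cuts S n nu cs \<and>
     \<not> (\<exists>cs'. tight_cuts S n nu cs' \<and> cut_union cs' \<subset> cut_union cs)"

text \<open>Gaps are tight, so every admissible union contains the complement \<open>V\<close> of
  the tight columns. Some cut sequence attains \<open>V\<close>, so \<open>V\<close> is least and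
  not merely minimal. Taking \<open>nu\<close> as the entries of a table makes
  \<open>tight_iff\<close> available.\<close>

lemma components_ex1:
  fixes c
  defines "nu \<equiv> entries c"
  obtains cs where "components nu cs" "\<And>cs'. components nu cs' \<Longrightarrow> cs' = cs"
    "cut_union cs = {1..<int n + 1} - tight_columns nu"
proof -
  define V where "V = {1..<int n + 1} - tight_columns nu"
  obtain a0 cs0 where cs0: "cut (int n + 1) ((1, a0) # cs0)" "cut_union ((1, a0) # cs0) = V"
    using cut_exists[of 1 "int n + 1" "tight_columns nu"] by (auto simp: V_def)
  define cs where "cs = (1, a0) # cs0"
  have cs: "cut (int n + 1) cs" "fst (hd cs) = 1" "cut_union cs = V"
    using cs0 by (simp_all add: cs_def)
  \<comment> \<open>A tight interval through a column of the gap misses \<open>V\<close>, while the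
    columns bordering the gap lie in \<open>V\<close> or off the shape. So it stays inside the gap
    and provides the witness that \<open>tight_iff\<close> asks for.\<close>
  have "tight nu x y" if xy: "(x, y) \<in> gaps cs" for x y
  proof -
    note gap = cut_gap[OF cs(1) xy] cut_gap_ends[OF cs(1) xy]
    have "\<exists>j. z = int j \<and> mix c j \<and> int ` supp S (c j - 1) \<subseteq> {x..<y}" if z: "z \<in> {x..<y}" for z
    proof -
      have "z \<in> tight_columns nu" using z gap(1) cs(2,3) by (auto simp: V_def)
      then obtain a b where ab: "tight nu a b" "a \<le> z" "z < b" by (auto simp: tight_columns_def)
      have cols: "{a..<b} \<inter> V = {}" using ab(1) by (auto simp: V_def intro: tight_columnsI)
      have bounds: "1 \<le> a" "b \<le> int n + 1" using tight_bounds[of c a b] ab by (auto simp: nu_def)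
      have "x \<le> a"
      proof (rule ccontr)
        assume "\<not> x \<le> a"
        then have "x - 1 \<in> V" "x - 1 \<in> {a..<b}" using gap(2) cs(2,3) bounds ab z by auto
        then show False using cols by blast
      qed
      moreover have "b \<le> y"
      proof (rule ccontr)
        assume "\<not> b \<le> y"
        then have "y \<in> V" "y \<in> {a..<b}" using gap(2) cs(3) bounds ab z by auto
        then show False using cols by blast
      qed
      moreover obtain j where "z = int j" "mix c j" "int ` supp S (c j - 1) \<subseteq> {a..<b}"
        using ab tight_iff[of a b c] unfolding nu_def by fastforce
      ultimately show ?thesis by fastforce
    qed
    then show ?thesis using gap(1) tight_iff[of x y c] by (simp add: nu_def)
  qed
  then have tight: "tight_cuts S n nu cs" using cs by (auto simp: tight_cuts_tight)
  have sub: "V \<subseteq> cut_union cs'" if cs': "tight_cuts S n nu cs'" for cs'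
  proof
    fix z assume z: "z \<in> V"
    have cs': "cut (int n + 1) cs'" "fst (hd cs') = 1" "\<forall>(x, y) \<in> gaps cs'. tight nu x y"
      using cs' by (auto simp: tight_cuts_tight)
    have "z \<in> cut_union cs' \<or> (\<exists>x y. (x, y) \<in> gaps cs' \<and> z \<in> {x..<y})"
      using cut_cover[OF cs'(1), of z] z cs'(2) by (auto simp: V_def)
    moreover have False if "(x, y) \<in> gaps cs'" "z \<in> {x..<y}" for x y
      using that cs'(3) z by (auto simp: V_def intro: tight_columnsI)
    ultimately show "z \<in> cut_union cs'" by blast
  qed
  have comp: "components nu cs" using tight sub cs(3) unfolding components_def by blast
  have unique: "cs' = cs" if "components nu cs'" for cs'
  proof -
    have cs': "tight_cuts S n nu cs'" "\<not> cut_union cs \<subset> cut_union cs'"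
      using that tight by (auto simp: components_def)
    then have "cut_union cs' = cut_union cs" using sub[of cs'] cs(3) by blast
    then show ?thesis using cs'(1) cs(1,2) by (intro cut_unique[of "int n + 1"]) (auto simp: tight_cuts_tight)
  qed
  show ?thesis
    by (rule that[of cs]) (fact comp, fact unique, fact cs(3)[unfolded V_def])
qed

text \<open>Entries are invariant along the chain, so the gaps stay tight and consist of mixed
  columns in every table of the chain; no pure column can cross them.\<close>

lemma count_resolves:
  assumes "(\<lambda>P Q. \<exists>k. resolves S k P Q)\<^sup>*\<^sup>* (tab p) Q" and p: "valid p"
    and cuts: "tight_cuts S n (entries p) cs"
  obtains q where "valid q" "Q = tab q" "entries q = entries p"
    "\<forall>(b, a) \<in> set cs. count one q b a = count one p b a \<and> count two q b a = count two p b a"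
proof -
  have "\<exists>q. valid q \<and> Q = tab q \<and> entries q = entries p \<and>
    (\<forall>(b, a) \<in> set cs. count one q b a = count one p b a \<and> count two q b a = count two p b a)"
    using assms(1)
  proof (induction rule: rtranclp_induct)
    case base
    then show ?case using p by blast
  next
    case (step Y Z)
    then obtain y where y: "valid y" "Y = tab y" "entries y = entries p"
      "\<forall>(b, a) \<in> set cs. count one y b a = count one p b a \<and> count two y b a = count two p b a"
      by blast
    obtain k where k: "resolves S k Y Z" using step by blast
    then have "table12 S Z" by (simp add: resolves_def benign_def)
    then obtain z where z: "valid z" "Z = tab z" by (rule table12_obtain)
    have rs: "resolve_step k y z" using resolves_tab[OF y(1) z(1)] k y(2) z(2) by simp
    have ent: "entries z = entries p" using entries_resolve_step[OF rs] y by simp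
    have cut: "cut (int n + 1) cs" "fst (hd cs) = 1" "\<forall>(x, y) \<in> gaps cs. tight (entries p) x y"
      using cuts by (auto simp: tight_cuts_tight)
    have gap_mix: "mix y j \<and> mix z j" if "(x, x') \<in> gaps cs" "x \<le> int j" "int j < x'" for x x' j
      using cut(3) that tight_mix[of y x x' j] tight_mix[of z x x' j] y(3) ent by auto
    have "count one z b a = count one y b a \<and> count two z b a = count two y b a"
      if "(b, a) \<in> set cs" for b a
    proof -
      \<comment> \<open>A column of the shape next to a component lies in a gap.\<close>
      have "mix y j \<and> mix z j" if j: "int j = b - 1 \<or> int j = a" "1 \<le> j" "j \<le> n" for j
        using j(1)
      proof
        assume jb: "int j = b - 1"
        then obtain w where w: "(w, b) \<in> gaps cs"
          using cut_member_ends[OF cut(1) \<open>(b, a) \<in> set cs\<close>] cut(2) j(2) by auto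
        then show ?thesis using gap_mix[OF w, of j] cut_gap[OF cut(1) w] jb by auto
      next
        assume ja: "int j = a"
        then obtain w where w: "(a, w) \<in> gaps cs"
          using cut_member_ends[OF cut(1) \<open>(b, a) \<in> set cs\<close>] j(3) by auto
        then show ?thesis using gap_mix[OF w, of j] cut_gap[OF cut(1) w] ja by auto
      qed
      then show ?thesis using count_resolve_step[OF rs, of b a] by blast
    qed
    then show ?case using y(4) z ent by (intro exI[of _ z]) fastforce
  qed
  then show ?thesis using that by blast
qed

text \<open>Used to recover the number of mixed columns of a component from its two pure
  counts.\<close>

lemma count_partition:
  assumes "valid c" "1 \<le> b" "b \<le> a" "a \<le> int n + 1"
  shows "card {j. mix c j \<and> nat b \<le> j \<and> j < nat a} + count one c b a + count two c b a = nat a - nat b"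
proof -
  let ?M = "{j. mix c j \<and> nat b \<le> j \<and> j < nat a}"
  let ?O = "{j. b \<le> int j \<and> int j < a \<and> one c j}"
  let ?T = "{j. b \<le> int j \<and> int j < a \<and> two c j}"
  have "{nat b..<nat a} = (?M \<union> ?O) \<union> ?T"
  proof (intro subset_antisym subsetI)
    fix j assume "j \<in> {nat b..<nat a}"
    then show "j \<in> (?M \<union> ?O) \<union> ?T"
      using column_cases[OF assms(1), of j] assms by (auto simp: nat_le_iff)
  next
    fix j assume "j \<in> (?M \<union> ?O) \<union> ?T"
    then show "j \<in> {nat b..<nat a}" using assms by auto
  qed
  moreover have "finite ?O" "finite ?T"
    by (rule finite_subset[of _ "{..n}"]; auto simp: one_def two_def)+
  moreover have "?M \<inter> ?O = {}" "(?M \<union> ?O) \<inter> ?T = {}"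
    using t_le_d by (fastforce simp: mix_def one_def two_def)+
  ultimately have "card {nat b..<nat a} = card ?M + card ?O + card ?T"
    by (simp add: card_Un_disjoint)
  then show ?thesis unfolding count_def by simp
qed

lemma rpp_determined:
  assumes c: "valid c" "anti c" and c': "valid c'" "anti c'" and ent: "entries c = entries c'"
    and cuts: "tight_cuts S n (entries c) cs"
    and union: "cut_union cs = {1..<int n + 1} - tight_columns (entries c)"
    and counts: "\<And>b a. (b, a) \<in> set cs \<Longrightarrow> count one c b a = count one c' b a \<and> count two c b a = count two c' b a"
  shows "tab c = tab c'"
proof -
  have cut: "cut (int n + 1) cs" "fst (hd cs) = 1" "\<forall>(x, y) \<in> gaps cs. tight (entries c) x y"
    using cuts by (auto simp: tight_cuts_tight)
  have gap_mix: "mix c j" "mix c' j" if "(x, y) \<in> gaps cs" "x \<le> int j" "int j < y" for x y j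
    using cut(3) that tight_mix[of c x y j] tight_mix[of c' x y j] ent by auto
  \<comment> \<open>Equality of the mixed counts to the left passes through a component because the
    pure counts agree there, and through a gap because all its columns are mixed in both
    tables.\<close>
  define Q where "Q x \<longleftrightarrow> mixed_before c (nat x) = mixed_before c' (nat x)" for x
  have Q: "\<forall>(x, y) \<in> set cs. Q x \<and> Q y"
  proof (rule cut_propagate[OF cut(1)])
    show "Q (fst (hd cs))" unfolding Q_def cut(2)
      by (auto simp: mixed_before_def mix_def intro: arg_cong[of _ _ card])
    show "\<forall>(x, y) \<in> set cs. Q x \<longrightarrow> Q y"
    proof clarify
      fix x y assume xy: "(x, y) \<in> set cs" "Q x"
      have b: "1 \<le> x" "x \<le> y" "y \<le> int n + 1"
        using cut_member_ends[OF cut(1) xy(1)] cut(2) by auto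
      then have "nat x \<le> nat y" by simp
      then show "Q y"
        using count_partition[OF c(1) b] count_partition[OF c'(1) b] counts[OF xy(1)] xy(2)
          mixed_before_add[of "nat x" "nat y" c] mixed_before_add[of "nat x" "nat y" c']
        unfolding Q_def by linarith
    qed
    show "\<forall>(x, y) \<in> gaps cs. Q x \<longrightarrow> Q y"
    proof clarify
      fix x y assume xy: "(x, y) \<in> gaps cs" "Q x"
      have b: "1 \<le> x" "x < y" using cut_gap[OF cut(1) xy(1)] cut(2) by auto
      have "mix c j" "mix c' j" if "nat x \<le> j" "j < nat y" for j
        using gap_mix[OF xy(1), of j] that b by auto
      then show "Q y" using xy(2) b mixed_before_all[of "nat x" "nat y" c]
          mixed_before_all[of "nat x" "nat y" c'] unfolding Q_def by simp
    qed
  qed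
  \<comment> \<open>A 2-pure column before a 1-pure one would produce a tight interval inside a
    component, but components contain no tight columns.\<close>
  have ord: "\<not> (two e p \<and> one e q)"
    if e: "valid e" "anti e" "entries e = entries c" and ba: "(b, a) \<in> set cs"
      and pq: "nat b \<le> p" "p < q" "q < nat a" for e b a p q
  proof
    assume "two e p \<and> one e q"
    then obtain x y where xy: "p < x" "x < y" "y \<le> q"
      "\<And>j. x \<le> j \<Longrightarrow> j < y \<Longrightarrow> mix e j \<and> supp S (e j - 1) \<subseteq> {x..<y}"
      using two_before_one[OF e(1,2) pq(2)] by metis
    have "tight (entries e) (int x) (int y)"
    proof (subst tight_iff)
      show "\<forall>z \<in> {int x..<int y}. \<exists>j. z = int j \<and> mix e j \<and> int ` supp S (e j - 1) \<subseteq> {int x..<int y}"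
      proof
        fix z assume z: "z \<in> {int x..<int y}"
        then obtain j where j: "z = int j" using nonneg_int_cases[of z] by force
        then have "x \<le> j" "j < y" using z by auto
        then have "mix e j" "supp S (e j - 1) \<subseteq> {x..<y}" using xy(4) by auto
        then show "\<exists>j. z = int j \<and> mix e j \<and> int ` supp S (e j - 1) \<subseteq> {int x..<int y}"
          using j by (intro exI[of _ j]) auto
      qed
    qed (use xy in simp)
    then have "int x \<in> tight_columns (entries c)"
      using xy(2) e(3) by (auto intro: tight_columnsI)
    moreover have "int x \<in> {b..<a}" using xy(1,2,3) pq by auto
    then have "int x \<in> cut_union cs" using ba unfolding cut_union_def by blast
    ultimately show False using union by blast
  qed
  have cmp: "comparable c c' (nat b) (nat a)" if ba: "(b, a) \<in> set cs" for b a
  proof -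
    have bd: "1 \<le> b" "b \<le> a" "a \<le> int n + 1"
      using cut_member_ends[OF cut(1) ba] cut(2) by auto
    have count: "card {j \<in> {nat b..<nat a}. P e j} = count P e b a" for P e
      unfolding count_def using bd by (intro arg_cong[of _ _ card]) auto
    have "mixed_before c (nat b) = mixed_before c' (nat b)" "mixed_before c (nat a) = mixed_before c' (nat a)"
      using Q ba by (auto simp: Q_def)
    then show ?thesis
      unfolding comparable_def count
      using c c' ent counts[OF ba] ord[OF c refl ba] ord[OF c' ent[symmetric] ba] bd
      by auto
  qed
  have "one c j = one c' j \<and> two c j = two c' j" if j: "1 \<le> j" "j \<le> n" for j
  proof -
    have "int j \<in> {fst (hd cs)..<int n + 1}" using j cut(2) by auto
    then consider "int j \<in> cut_union cs" | x y where "(x, y) \<in> gaps cs" "int j \<in> {x..<y}"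
      using cut_cover[OF cut(1)] by blast
    then show ?thesis
    proof cases
      case 1
      then obtain b a where ba: "(b, a) \<in> set cs" "b \<le> int j" "int j < a"
        by (auto simp: cut_union_def)
      then have "nat b \<le> j" "j < nat a" by auto
      then show ?thesis using comparable_one_eq comparable_two_eq cmp[OF ba(1)] by blast
    next
      case 2
      then have "mix c j" "mix c' j" using gap_mix by auto
      then show ?thesis by (auto simp: mix_def one_def two_def)
    qed
  qed
  then show ?thesis
    using threshold_determined[OF c(1) c'(1) ent] by (intro tab_cong) blast
qed

section \<open>The map \<open>B\<close> and its effect on pure counts\<close>

lemma pure_count_tab:
  "valid c \<Longrightarrow> pure_count 1 S (tab c) b a = count one c b a"
  "valid c \<Longrightarrow> pure_count 2 S (tab c) b a = count two c b a"
  unfolding pure_count_def count_def by (simp_all only: pure_1_tab pure_2_tab)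

lemma RPP12_obtain:
  assumes "T \<in> RPP12 S nu"
  obtains c where "valid c" "anti c" "entries c = nu" "T = tab c"
proof -
  have T: "rpp12 S T" "seplist S T = nu" using assms by (auto simp: RPP12_def)
  then have "table12 S T" by (simp add: rpp12_def)
  then obtain c where "valid c" "T = tab c" by (rule table12_obtain)
  then show ?thesis using that T by (simp add: rpp12_tab seplist_tab)
qed

text \<open>The criterion behind all later equalities: uniqueness of the normal form,
  \<open>B\<close> being an involution, and uniqueness of \<open>f\<close>.\<close>

lemma RPP12_eqI:
  assumes "components nu cs" "T \<in> RPP12 S nu" "T' \<in> RPP12 S nu"
    and "\<And>b a. (b, a) \<in> set cs \<Longrightarrow> pure_count 1 S T b a = pure_count 1 S T' b a \<and>
      pure_count 2 S T b a = pure_count 2 S T' b a"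
  shows "T = T'"
proof -
  obtain c where c: "valid c" "anti c" "entries c = nu" "T = tab c"
    using assms(2) by (rule RPP12_obtain)
  obtain c' where c': "valid c'" "anti c'" "entries c' = nu" "T' = tab c'"
    using assms(3) by (rule RPP12_obtain)
  have "tight_cuts S n nu cs" using assms(1) by (simp add: components_def)
  moreover have "cut_union cs = {1..<int n + 1} - tight_columns nu"
    using components_ex1[of c] assms(1) unfolding c(3) by metis
  ultimately show ?thesis
    using rpp_determined[OF c(1,2) c'(1,2), of cs] assms(4) c c' by (simp add: pure_count_tab del: One_nat_def)
qed

lemma B_swaps:
  assumes "components nu cs" "T \<in> RPP12 S nu"
  shows "B S T \<in> RPP12 S nu \<and> (\<forall>(b, a) \<in> set cs.
    pure_count 1 S (B S T) b a = pure_count 2 S T b a \<and>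
    pure_count 2 S (B S T) b a = pure_count 1 S T b a)"
proof -
  obtain c where c: "valid c" "anti c" "entries c = nu" "T = tab c"
    using assms(2) by (rule RPP12_obtain)
  define p where "p = flipped c"
  have p: "valid p" "benign S (tab p)" "entries p = nu" "flip S T = tab p"
    using c by (simp_all add: p_def valid_flipped benign_flipped entries_flipped flip_tab)
  have cuts: "tight_cuts S n (entries p) cs" using assms(1) p(3) by (simp add: components_def)
  let ?norm = "\<lambda>Q. rpp12 S Q \<and> (\<lambda>P Q. \<exists>k. resolves S k P Q)\<^sup>*\<^sup>* (tab p) Q"
  \<comment> \<open>Shown for every normal form of the flipped table, so that any two of them are
    equal by \<open>RPP12_eqI\<close> and the \<open>THE\<close> in \<open>norm12\<close> is
    justified.\<close>
  have swapped: "Q \<in> RPP12 S nu \<and> (\<forall>(b, a) \<in> set cs.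
      pure_count 1 S Q b a = pure_count 2 S T b a \<and> pure_count 2 S Q b a = pure_count 1 S T b a)"
    if norm: "?norm Q" for Q
  proof -
    obtain q where q: "valid q" "Q = tab q" "entries q = entries p"
      "\<forall>(b, a) \<in> set cs. count one q b a = count one p b a \<and> count two q b a = count two p b a"
      by (rule count_resolves[OF conjunct2[OF norm] p(1) cuts])
    have "Q \<in> RPP12 S nu" using norm q(1-3) p(3) by (simp add: RPP12_def seplist_tab)
    moreover have "count one p b a = count two c b a" "count two p b a = count one c b a" for b a
      by (simp_all add: count_def p_def one_flipped two_flipped)
    ultimately show ?thesis using q c(1,4) by (auto simp: pure_count_tab simp del: One_nat_def)
  qed
  obtain Q where Q: "?norm Q" using norm_exists[OF p(1,2)] by blast
  have "Q' = Q" if "?norm Q'" for Q'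
    by (rule RPP12_eqI[OF assms(1)]) (use swapped[OF Q] swapped[OF that] in force)+
  then have "norm12 S (tab p) = Q" unfolding norm12_def using Q by (intro the_equality) blast+
  then show ?thesis using swapped[OF Q] by (simp add: B_def p(4))
qed

end

section \<open>From skew partitions to column shapes\<close>

definition conj_part :: "nat list \<Rightarrow> nat \<Rightarrow> nat" where
  "conj_part xs j = length (filter (\<lambda>x. j \<le> x) xs)"

lemma conj_part_Suc: "conj_part xs (Suc j) \<le> conj_part xs j"
  by (induction xs) (auto simp: conj_part_def)

text \<open>In a weakly decreasing list the parts that are at least \<open>j\<close> form a prefix,
  so \<open>conj_part xs j\<close> is the length of column \<open>j\<close>.\<close>

lemma mem_diagram:
  assumes "is_partition xs"
  shows "(i, j) \<in> diagram xs \<longleftrightarrow> 1 \<le> j \<and> 1 \<le> i \<and> i \<le> conj_part xs j"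
proof -
  have "k < length xs \<and> j \<le> xs ! k \<longleftrightarrow> k < conj_part xs j" for k
    using assms unfolding is_partition_def conj_part_def
  proof (induction xs arbitrary: k)
    case (Cons x xs)
    have "filter (\<lambda>x. j \<le> x) xs = []" if "\<not> j \<le> x"
      using that Cons(2) by (auto simp: filter_empty_conv)
    moreover have "k < length (x # xs) \<and> j \<le> (x # xs) ! k \<Longrightarrow> j \<le> x"
      using Cons(2) by (cases k) (auto dest: nth_mem intro: order_trans)
    ultimately show ?case using Cons by (cases k) auto
  qed simp
  from this[of "i - 1"] show ?thesis
    unfolding diagram_def part_def by (cases i) auto
qed

lemma column_shape_skew:
  assumes "skew_partition la mu" "connected_cells (skew la mu)" "no_empty_columns la mu"
  shows "column_shape (skew la mu) (part la 1) (\<lambda>j. Suc (conj_part mu j)) (conj_part la)"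
proof -
  have la: "is_partition la" and mu: "is_partition mu"
    using assms(1) by (auto simp: skew_partition_def)
  have le_part: "j \<le> part la 1" if "1 \<le> i" "i \<le> conj_part la j" "1 \<le> j" for i j
  proof -
    have "(1, j) \<in> diagram la" using that mem_diagram[OF la] by simp
    then show ?thesis by (simp add: diagram_def)
  qed
  have mem: "(i, j) \<in> skew la mu \<longleftrightarrow>
      1 \<le> j \<and> j \<le> part la 1 \<and> Suc (conj_part mu j) \<le> i \<and> i \<le> conj_part la j" for i j
    unfolding skew_def using mem_diagram[OF la] mem_diagram[OF mu] le_part[of i j] by auto
  have nonempty: "\<exists>i. (i, j) \<in> skew la mu" if "1 \<le> j" "j \<le> part la 1" for j
    using assms(3) that by (auto simp: no_empty_columns_def)
  show ?thesis
  proof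
    show "Suc (conj_part mu j) \<le> conj_part la j" if "1 \<le> j" "j \<le> part la 1" for j
      using nonempty[OF that] by (auto simp: mem)
    show "Suc (conj_part mu j) \<le> conj_part la (Suc j)" if j: "1 \<le> j" "j < part la 1" for j
    proof (rule ccontr)
      assume no_overlap: "\<not> Suc (conj_part mu j) \<le> conj_part la (Suc j)"
      obtain i i' where cells: "(i, j) \<in> skew la mu" "(i', Suc j) \<in> skew la mu"
        using nonempty[of j] nonempty[of "Suc j"] j by auto
      \<comment> \<open>Without a common row of columns \<open>j\<close> and \<open>Suc j\<close>,
        no path leaves the first \<open>j\<close> columns, which contradicts connectedness.\<close>
      have stays: "snd y \<le> j" if xy: "snd x \<le> j" "x \<in> skew la mu" "y \<in> skew la mu" "adjacent x y" for x y
      proof (rule ccontr)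
        assume "\<not> snd y \<le> j"
        then obtain r where "x = (r, j)" "y = (r, Suc j)"
          using xy(1,4) by (cases x; cases y) auto
        then show False using xy(2,3) no_overlap by (auto simp: mem)
      qed
      have "snd z \<le> j" if "(\<lambda>x y. x \<in> skew la mu \<and> y \<in> skew la mu \<and> adjacent x y)\<^sup>*\<^sup>* (i, j) z" for z
        using that by (induction rule: rtranclp_induct) (auto intro: stays)
      then have "snd (i', Suc j) \<le> j"
        using assms(2) cells unfolding connected_cells_def by blast
      then show False by simp
    qed
  qed (auto simp: mem conj_part_Suc)
qed

theorem corollary7p11:
  fixes la mu nu :: "nat list"
  assumes "skew_partition la mu"
    and "connected_cells (skew la mu)"
    and "no_empty_columns la mu"
    and "is_partition nu"
    and "representable (skew la mu) nu"
  shows "involution_on (RPP12 (skew la mu) nu) (B (skew la mu)) \<and>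
    interchanges_pure la mu nu (B (skew la mu)) \<and>
    (\<forall>f. involution_on (RPP12 (skew la mu) nu) f \<and> interchanges_pure la mu nu f \<longrightarrow>
       (\<forall>T \<in> RPP12 (skew la mu) nu. f T = B (skew la mu) T))"
\<comment> \<open>All claims quantify over this set. A member supplies thresholds \<open>c\<close>
  with \<open>entries c = nu\<close>, from which \<open>components_ex1\<close> yields the
  components.\<close>
proof (cases "RPP12 (skew la mu) nu = {}")
  case True
  then show ?thesis by (auto simp: involution_on_def interchanges_pure_def)
next
  case False
  interpret column_shape "skew la mu" "part la 1" "\<lambda>j. Suc (conj_part mu j)" "conj_part la"
    using assms by (intro column_shape_skew)
  let ?X = "RPP12 (skew la mu) nu"
  define cs where "cs = component_columns la mu nu"
  obtain T0 c where "T0 \<in> ?X" "entries c = nu" using False RPP12_obtain by blast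
  then obtain cs0 where "components nu cs0" "\<And>cs'. components nu cs' \<Longrightarrow> cs' = cs0"
    using components_ex1[of c] by metis
  then have cs: "components nu cs"
    unfolding cs_def component_columns_def components_def[symmetric] by (rule theI)
  note swaps = B_swaps[OF cs]
  \<comment> \<open>Two exchanges restore the pure counts of \<open>T\<close> in every
    component.\<close>
  have "B (skew la mu) (B (skew la mu) T) = T" if "T \<in> ?X" for T
    by (rule RPP12_eqI[OF cs]) (use swaps[OF that] swaps[of "B (skew la mu) T"] that in force)+
  then have "involution_on ?X (B (skew la mu))"
    using swaps unfolding involution_on_def by blast
  moreover have "interchanges_pure la mu nu (B (skew la mu))"
    using swaps unfolding interchanges_pure_def cs_def[symmetric] by blast
  moreover have "f T = B (skew la mu) T"
    if f: "involution_on ?X f" "interchanges_pure la mu nu f" and T: "T \<in> ?X" for f T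
  proof (rule RPP12_eqI[OF cs])
    show "f T \<in> ?X" using f(1) T by (auto simp: involution_on_def)
  qed (use swaps[OF T] f(2) T in \<open>force simp: interchanges_pure_def cs_def[symmetric]\<close>)+
  ultimately show ?thesis by blast
qed

end
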